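(* Let $(n_1,n_2,n_3)\in\{(1,1,1),(1,1,2),(1,1,3)\}$, $n=n_1+n_2+n_3$, $V=\mathbb{C}^{n_1+1}\otimes\mathbb{C}^{n_2+1}\otimes\mathbb{C}^{n_3+1}\otimes\mathbb{C}^{n+2}$, and let $T\in V$ be a general tensor. Then $\langle Z_T\rangle\subsetneq\mathbb{P}(H_T)$.
   Context: Everything is over $\mathbb{C}$. "General" means: for all $T$ in some nonempty Zariski open subset of the tensor space. Let $V=V_1\otimes\cdots\otimes V_m$ with $\dim V_i=n_i+1$ (here $m=4$, $n_4=n+1$), each $V_i$ equipped with the complexification of a positive definite real quadratic form; use orthonormal coordinates, so that $V_i$ is identified with its dual. A singular vector $m$-tuple of $T=(t_{i_1\cdots i_m})\in V$ is a tuple $(\mathbf{x}_1,\dots,\mathbf{x}_m)$ of nonzero vectors $\mathbf{x}_i\in V_i$ such that for every $i$ the contraction $T(\mathbf{x}_1\otimes\cdots\otimes\widehat{\mathbf{x}_i}\otimes\cdots\otimes\mathbf{x}_m)\in V_i$ and $\mathbf{x}_i$ are linearly dependent. $Z_T\subset\mathbb{P}(V)$ is the set of points $[\mathbf{x}_1\otimes\cdots\otimes\mathbf{x}_m]$ with $(\mathbf{x}_i)_i$ a singular vector $m$-tuple of $T$; $\langle Z_T\rangle$ is its projective linear span. The critical space $H_T\subset V$ is the linear subspace of all $z=(z_{i_1\cdots i_m})$ such that for all $\ell$ and all $1\le p<q\le n_\ell+1$, $\sum\left(t_{i_1\cdots p\cdots i_m}z_{i_1\cdots q\cdots i_m}-t_{i_1\cdots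 q\cdots i_m}z_{i_1\cdots p\cdots i_m}\right)=0$ ($p,q$ in position $\ell$, sum over the other indices). *)

theory Defs
  imports Complex_Main "HOL-Library.Function_Algebras"
begin

text \<open>
  A tensor of format \<open>d = [d\<^sub>1, \<dots>, d\<^sub>m]\<close> is its coordinate array with respect to the orthonormal
  bases: a function on multi-indices, zero outside the index range. Indices and tensor
  positions are counted from 0, so that position \<open>l < length d\<close> has dimension \<open>d ! l\<close>. As the
  bases are orthonormal, \<open>V\<^sub>l\<close> is its own dual and contractions are bilinear (not Hermitian).
\<close>

definition multi_indices :: "nat list \<Rightarrow> nat list set" where
  "multi_indices d = {I. length I = length d \<and> (\<forall>l<length d. I ! l < d ! l)}"

definition coord_space :: "nat \<Rightarrow> (nat \<Rightarrow> complex) set" where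
  "coord_space k = {v. \<forall>j. j \<ge> k \<longrightarrow> v j = 0}"

definition tensor_space :: "nat list \<Rightarrow> (nat list \<Rightarrow> complex) set" where
  "tensor_space d = {T. \<forall>I. I \<notin> multi_indices d \<longrightarrow> T I = 0}"

definition cscale :: "complex \<Rightarrow> ('i \<Rightarrow> complex) \<Rightarrow> 'i \<Rightarrow> complex" where
  "cscale c f = (\<lambda>i. c * f i)"

interpretation cfun: vector_space "cscale :: complex \<Rightarrow> ('i \<Rightarrow> complex) \<Rightarrow> 'i \<Rightarrow> complex"
  by unfold_locales (auto simp: cscale_def fun_eq_iff algebra_simps)


subsection \<open>Zariski topology on the tensor space\<close>

inductive_set polynomial_functions :: "nat list \<Rightarrow> ((nat list \<Rightarrow> complex) \<Rightarrow> complex) set"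
  for d :: "nat list" where
  const: "(\<lambda>T. c) \<in> polynomial_functions d"
| coord: "I \<in> multi_indices d \<Longrightarrow> (\<lambda>T. T I) \<in> polynomial_functions d"
| add: "f \<in> polynomial_functions d \<Longrightarrow> g \<in> polynomial_functions d \<Longrightarrow>
    (\<lambda>T. f T + g T) \<in> polynomial_functions d"
| mult: "f \<in> polynomial_functions d \<Longrightarrow> g \<in> polynomial_functions d \<Longrightarrow>
    (\<lambda>T. f T * g T) \<in> polynomial_functions d"

definition zariski_open :: "nat list \<Rightarrow> (nat list \<Rightarrow> complex) set \<Rightarrow> bool" where
  "zariski_open d U \<longleftrightarrow>
    (\<exists>F \<subseteq> polynomial_functions d. U = tensor_space d - {T. \<forall>f\<in>F. f T = 0})"

definition holds_for_general_tensor :: "nat list \<Rightarrow> ((nat list \<Rightarrow> complex) \<Rightarrow> bool) \<Rightarrow> bool" where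
  "holds_for_general_tensor d P \<longleftrightarrow> (\<exists>U. zariski_open d U \<and> U \<noteq> {} \<and> (\<forall>T\<in>U. P T))"


subsection \<open>Projective space\<close>

text \<open>Points of projective space are the lines through the origin.\<close>

definition proj_point :: "('i \<Rightarrow> complex) \<Rightarrow> ('i \<Rightarrow> complex) set" where
  "proj_point v = cfun.span {v}"

definition projectivization :: "('i \<Rightarrow> complex) set \<Rightarrow> ('i \<Rightarrow> complex) set set" where
  "projectivization W = proj_point ` (W - {0})"

text \<open>The smallest projective linear subspace containing \<open>Z\<close>.\<close>

definition proj_span :: "nat list \<Rightarrow> (nat list \<Rightarrow> complex) set set \<Rightarrow> (nat list \<Rightarrow> complex) set set" where
  "proj_span d Z =
    \<Inter>{projectivization W | W. cfun.subspace W \<and> W \<subseteq> tensor_space d \<and> Z \<subseteq> projectivization W}"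


subsection \<open>Singular vector tuples and the critical space\<close>

text \<open>The tensor \<open>x\<^sub>1 \<otimes> \<dots> \<otimes> x\<^sub>m\<close>.\<close>

definition rank_one_tensor :: "nat list \<Rightarrow> (nat \<Rightarrow> complex) list \<Rightarrow> nat list \<Rightarrow> complex" where
  "rank_one_tensor d xs =
    (\<lambda>I. if I \<in> multi_indices d then \<Prod>l<length d. (xs ! l) (I ! l) else 0)"

text \<open>Contraction of \<open>T\<close> with all the vectors of the tuple except the one in position \<open>l\<close>.\<close>

definition contraction ::
    "nat list \<Rightarrow> (nat list \<Rightarrow> complex) \<Rightarrow> (nat \<Rightarrow> complex) list \<Rightarrow> nat \<Rightarrow> nat \<Rightarrow> complex" where
  "contraction d T xs l =
    (\<lambda>p. \<Sum>I | I \<in> multi_indices d \<and> I ! l = p. T I * (\<Prod>k\<in>{..<length d} - {l}. (xs ! k) (I ! k)))"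

definition linearly_dependent_pair :: "('i \<Rightarrow> complex) \<Rightarrow> ('i \<Rightarrow> complex) \<Rightarrow> bool" where
  "linearly_dependent_pair u v \<longleftrightarrow>
    (\<exists>a b. (a, b) \<noteq> (0, 0) \<and> cscale a u + cscale b v = 0)"

definition singular_vector_tuple ::
    "nat list \<Rightarrow> (nat list \<Rightarrow> complex) \<Rightarrow> (nat \<Rightarrow> complex) list \<Rightarrow> bool" where
  "singular_vector_tuple d T xs \<longleftrightarrow>
    length xs = length d \<and>
    (\<forall>l<length d. xs ! l \<in> coord_space (d ! l) \<and> xs ! l \<noteq> 0 \<and>
      linearly_dependent_pair (contraction d T xs l) (xs ! l))"

definition singular_points :: "nat list \<Rightarrow> (nat list \<Rightarrow> complex) \<Rightarrow> (nat list \<Rightarrow> complex) set set" where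
  "singular_points d T = {proj_point (rank_one_tensor d xs) | xs. singular_vector_tuple d T xs}"

definition critical_space :: "nat list \<Rightarrow> (nat list \<Rightarrow> complex) \<Rightarrow> (nat list \<Rightarrow> complex) set" where
  "critical_space d T = {z \<in> tensor_space d.
    \<forall>l<length d. \<forall>p q. p < q \<and> q < d ! l \<longrightarrow>
      (\<Sum>I | I \<in> multi_indices d \<and> I ! l = p. T I * z (I[l := q]) - T (I[l := q]) * z I) = 0}"

end

theory Submission
  imports Defs "HOL-Computational_Algebra.Polynomial"
begin

text \<open>
  Write \<open>\<phi>\<close> for the contraction of \<open>T\<close> with three vectors and \<open>W\<close> for the span of the tensors
  \<open>x \<otimes> y \<otimes> z \<otimes> \<phi>(x, y, z)\<close>. As the last dimension exceeds that of the boundary format, \<open>\<phi>\<close> has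
  no zeros for general \<open>T\<close>, so every singular tuple lies in \<open>W\<close>, and it suffices to find an element
  of the critical space outside \<open>W\<close>. The entries of the spanning tensors are forms of
  degree \<open>(2, 2, 2)\<close> in \<open>(x, y, z)\<close>, which bounds \<open>dim W\<close> by 27, 54, 90 in the three formats.
  The critical equations of the last position number 10, 15, 21 and hold on \<open>W\<close>; since
  40 > 27 + 10, 72 > 54 + 15 and 112 > 90 + 21, they have a solution \<open>z\<close> outside \<open>W\<close>. For general
  \<open>T\<close> the remaining critical equations are linearly independent on \<open>W\<close>, so subtracting an
  element of \<open>W\<close> from \<open>z\<close> achieves those as well.

  Both genericity statements say that a linear system with coefficients polynomial in \<open>T\<close> has only
  the zero solution, so each needs to be verified for just one tensor: for the first, the
  multiplication of polynomials in one variable; for the second, a single nonzero slice.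
\<close>

section \<open>General tensors\<close>

lemma polynomial_functions_diff:
  assumes "f \<in> polynomial_functions d" "g \<in> polynomial_functions d"
  shows "(\<lambda>T. f T - g T) \<in> polynomial_functions d"
  using polynomial_functions.add[OF assms(1) polynomial_functions.mult[OF polynomial_functions.const assms(2), of "-1"]]
  by simp

lemma polynomial_functions_sum:
  assumes "\<And>a. a \<in> A \<Longrightarrow> f a \<in> polynomial_functions d"
  shows "(\<lambda>T. \<Sum>a\<in>A. f a T) \<in> polynomial_functions d"
  using assms
  by (induction A rule: infinite_finite_induct)
    (auto intro: polynomial_functions.const polynomial_functions.add)

lemma polynomial_functions_if:
  assumes "b \<Longrightarrow> f \<in> polynomial_functions d" "\<not> b \<Longrightarrow> g \<in> polynomial_functions d"
  shows "(\<lambda>T. if b then f T else g T) \<in> polynomial_functions d"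
  using assms by (cases b) simp_all

text \<open>The nonvanishing locus of a single polynomial is Zariski open; the point
  \<open>T\<close> makes it nonempty.\<close>

lemma holds_for_general_tensorI:
  assumes "f \<in> polynomial_functions d" "T \<in> tensor_space d" "f T \<noteq> 0"
    and "\<And>T. T \<in> tensor_space d \<Longrightarrow> f T \<noteq> 0 \<Longrightarrow> P T"
  shows "holds_for_general_tensor d P"
  unfolding holds_for_general_tensor_def zariski_open_def
  using assms by (intro exI[of _ "tensor_space d - {T. \<forall>g\<in>{f}. g T = 0}"] conjI exI[of _ "{f}"]) auto

text \<open>Some member of the family cutting out the complement is nonzero at a point of the open
  set, and its whole nonvanishing locus lies in that set.\<close>

lemma holds_for_general_tensorE:
  assumes "holds_for_general_tensor d P"
  obtains f T where "f \<in> polynomial_functions d" "T \<in> tensor_space d" "f T \<noteq> 0"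
    "\<And>T. T \<in> tensor_space d \<Longrightarrow> f T \<noteq> 0 \<Longrightarrow> P T"
  using assms unfolding holds_for_general_tensor_def zariski_open_def by blast

lemma holds_for_general_tensor_mono:
  assumes "holds_for_general_tensor d P" "\<And>T. P T \<Longrightarrow> Q T"
  shows "holds_for_general_tensor d Q"
  using assms unfolding holds_for_general_tensor_def by blast

lemma polynomial_functions_on_line:
  assumes "f \<in> polynomial_functions d"
  shows "\<exists>p. \<forall>t. f (\<lambda>I. A I + t * B I) = poly p t"
  using assms
proof induction
  case (const c)
  show ?case by (rule exI[of _ "[:c:]"]) simp
next
  case (coord I)
  show ?case by (rule exI[of _ "[:A I, B I:]"]) simp
next
  case (add f g)
  then show ?case by (metis poly_add)
next
  case (mult f g)
  then show ?case by (metis poly_mult)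
qed

text \<open>The tensor space is irreducible: two nonzero polynomial functions are both nonzero
  at some point of the line through points where they do not vanish.\<close>

lemma holds_for_general_tensor_conj:
  assumes "holds_for_general_tensor d P" "holds_for_general_tensor d Q"
  shows "holds_for_general_tensor d (\<lambda>T. P T \<and> Q T)"
proof -
  obtain f A where f: "f \<in> polynomial_functions d" "A \<in> tensor_space d" "f A \<noteq> 0"
    "\<And>T. T \<in> tensor_space d \<Longrightarrow> f T \<noteq> 0 \<Longrightarrow> P T"
    using assms(1) by (rule holds_for_general_tensorE) blast
  obtain g B where g: "g \<in> polynomial_functions d" "B \<in> tensor_space d" "g B \<noteq> 0"
    "\<And>T. T \<in> tensor_space d \<Longrightarrow> g T \<noteq> 0 \<Longrightarrow> Q T"
    using assms(2) by (rule holds_for_general_tensorE) blast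
  define C where "C t = (\<lambda>I. A I + t * (B I - A I))" for t
  obtain p where p: "\<And>t. f (C t) = poly p t"
    using polynomial_functions_on_line[OF f(1), of A "\<lambda>I. B I - A I"] unfolding C_def by blast
  obtain q where q: "\<And>t. g (C t) = poly q t"
    using polynomial_functions_on_line[OF g(1), of A "\<lambda>I. B I - A I"] unfolding C_def by blast
  have "C 0 = A" "C 1 = B" by (auto simp: C_def)
  then have "p \<noteq> 0" "q \<noteq> 0" using p[of 0] q[of 1] f(3) g(3) by auto
  then have "finite {t. poly (p * q) t = 0}" by (intro poly_roots_finite) simp
  then obtain t where "poly (p * q) t \<noteq> 0"
    using ex_new_if_finite[OF infinite_UNIV_char_0] by blast
  moreover have "C t \<in> tensor_space d" using f(2) g(2) by (simp add: C_def tensor_space_def)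
  ultimately show ?thesis
    using p[of t] q[of t]
    by (intro holds_for_general_tensorI[where T = "C t", OF polynomial_functions.mult[OF f(1) g(1)]])
      (auto intro: f(4) g(4))
qed

text \<open>Elimination of one unknown by a pivot that is nonzero at \<open>T\<^sub>0\<close>, without division.\<close>

lemma injective_system_polynomial:
  assumes "finite C"
    and "\<And>r c. r \<in> R \<Longrightarrow> c \<in> C \<Longrightarrow> A r c \<in> polynomial_functions d"
    and "\<And>v. (\<And>r. r \<in> R \<Longrightarrow> (\<Sum>c\<in>C. v c * A r c T0) = 0) \<Longrightarrow> (\<forall>c\<in>C. v c = 0)"
  shows "\<exists>f\<in>polynomial_functions d. f T0 \<noteq> 0 \<and>
    (\<forall>T. f T \<noteq> 0 \<longrightarrow> (\<forall>v. (\<forall>r\<in>R. (\<Sum>c\<in>C. v c * A r c T) = 0) \<longrightarrow> (\<forall>c\<in>C. v c = 0)))"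
  using assms
proof (induction C arbitrary: A rule: finite_induct)
  case empty
  show ?case by (rule bexI[OF _ polynomial_functions.const[of 1]]) auto
next
  case (insert c0 C)
  \<comment> \<open>If the column \<open>c0\<close> were zero at \<open>T0\<close>, the unit vector
    at \<open>c0\<close> would be a nonzero solution.\<close>
  have "\<exists>r0\<in>R. A r0 c0 T0 \<noteq> 0"
  proof (rule ccontr)
    assume "\<not> ?thesis"
    then have z: "A r c0 T0 = 0" if "r \<in> R" for r using that by blast
    have "(\<Sum>c\<in>insert c0 C. of_bool (c = c0) * A r c T0) = 0" if "r \<in> R" for r
      using z[OF that] by (intro sum.neutral) auto
    from insert.prems(2)[of "\<lambda>c. of_bool (c = c0)", OF this] show False by auto
  qed
  then obtain r0 where r0: "r0 \<in> R" "A r0 c0 T0 \<noteq> 0" by blast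
  \<comment> \<open>Cross-multiplying row \<open>r\<close> with the pivot row clears column
    \<open>c0\<close> and keeps the entries polynomial.\<close>
  define A' where "A' r c T = A r0 c0 T * A r c T - A r c0 T * A r0 c T" for r c T
  have expand: "(\<Sum>c\<in>C. v c * A' r c T) =
      A r0 c0 T * (\<Sum>c\<in>C. v c * A r c T) - A r c0 T * (\<Sum>c\<in>C. v c * A r0 c T)" for v r T
    by (simp add: A'_def sum_distrib_left sum_subtractf algebra_simps)
  have "\<exists>f\<in>polynomial_functions d. f T0 \<noteq> 0 \<and>
    (\<forall>T. f T \<noteq> 0 \<longrightarrow> (\<forall>v. (\<forall>r\<in>R. (\<Sum>c\<in>C. v c * A' r c T) = 0) \<longrightarrow> (\<forall>c\<in>C. v c = 0)))"
  proof (rule insert.IH)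
    fix r c assume rc: "r \<in> R" "c \<in> C"
    have "(\<lambda>T. A r0 c0 T * A r c T - A r c0 T * A r0 c T) \<in> polynomial_functions d"
      using rc r0(1) insert.prems(1)
      by (intro polynomial_functions_diff polynomial_functions.mult) auto
    then show "A' r c \<in> polynomial_functions d" by (simp add: A'_def[abs_def])
  next
    fix v assume v: "\<And>r. r \<in> R \<Longrightarrow> (\<Sum>c\<in>C. v c * A' r c T0) = 0"
    \<comment> \<open>A solution of the reduced system extends to column \<open>c0\<close> by the
      value that the pivot row forces.\<close>
    define u where "u = v(c0 := - (\<Sum>c\<in>C. v c * A r0 c T0) / A r0 c0 T0)"
    have uC: "(\<Sum>c\<in>C. u c * A r c T0) = (\<Sum>c\<in>C. v c * A r c T0)" for r
      using insert.hyps by (intro sum.cong) (auto simp: u_def)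
    have "(\<Sum>c\<in>insert c0 C. u c * A r c T0) = 0" if "r \<in> R" for r
      using v[OF that] r0 insert.hyps unfolding expand
      by (simp add: uC) (simp add: u_def field_simps)
    from insert.prems(2)[OF this] show "\<forall>c\<in>C. v c = 0"
      using insert.hyps by (auto simp: u_def split: if_splits)
  qed
  then obtain f where f: "f \<in> polynomial_functions d" "f T0 \<noteq> 0"
    "\<And>T v. f T \<noteq> 0 \<Longrightarrow> \<forall>r\<in>R. (\<Sum>c\<in>C. v c * A' r c T) = 0 \<Longrightarrow> \<forall>c\<in>C. v c = 0" by blast
  show ?case
  proof (intro bexI[where x = "\<lambda>T. A r0 c0 T * f T"] conjI allI impI)
    show "(\<lambda>T. A r0 c0 T * f T) \<in> polynomial_functions d"
      using f(1) r0(1) insert.prems(1) by (intro polynomial_functions.mult) auto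
    show "A r0 c0 T0 * f T0 \<noteq> 0" using r0 f by simp
    fix T v
    assume T: "A r0 c0 T * f T \<noteq> 0" and v: "\<forall>r\<in>R. (\<Sum>c\<in>insert c0 C. v c * A r c T) = 0"
    have eq: "(\<Sum>c\<in>C. v c * A r c T) = - (v c0 * A r c0 T)" if "r \<in> R" for r
      using v that insert.hyps by (simp add: eq_neg_iff_add_eq_0 add.commute)
    have vC: "\<forall>c\<in>C. v c = 0"
      using T r0(1) by (intro f(3)[of T v]) (auto simp: expand eq)
    moreover have "v c0 = 0" using eq[OF r0(1)] T vC by simp
    ultimately show "\<forall>c\<in>insert c0 C. v c = 0" by simp
  qed
qed

text \<open>The open condition is that a product of \<open>card C\<close> pivots is nonzero. The row
  set \<open>R\<close> may be infinite, so equations can be imposed at all triples of vectors at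
  once.\<close>

lemma holds_for_general_tensor_injective_system:
  assumes "finite C"
    and "\<And>r c. r \<in> R \<Longrightarrow> c \<in> C \<Longrightarrow> A r c \<in> polynomial_functions d"
    and "T0 \<in> tensor_space d"
    and "\<And>v. (\<And>r. r \<in> R \<Longrightarrow> (\<Sum>c\<in>C. v c * A r c T0) = 0) \<Longrightarrow> (\<forall>c\<in>C. v c = 0)"
  shows "holds_for_general_tensor d
    (\<lambda>T. \<forall>v. (\<forall>r\<in>R. (\<Sum>c\<in>C. v c * A r c T) = 0) \<longrightarrow> (\<forall>c\<in>C. v c = 0))"
proof -
  have "\<exists>f\<in>polynomial_functions d. f T0 \<noteq> 0 \<and>
    (\<forall>T. f T \<noteq> 0 \<longrightarrow> (\<forall>v. (\<forall>r\<in>R. (\<Sum>c\<in>C. v c * A r c T) = 0) \<longrightarrow> (\<forall>c\<in>C. v c = 0)))"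
    using assms(1,2,4) by (rule injective_system_polynomial) auto
  then obtain f where "f \<in> polynomial_functions d" "f T0 \<noteq> 0"
    "\<forall>T. f T \<noteq> 0 \<longrightarrow> (\<forall>v. (\<forall>r\<in>R. (\<Sum>c\<in>C. v c * A r c T) = 0) \<longrightarrow> (\<forall>c\<in>C. v c = 0))" by blast
  with assms(3) show ?thesis by (intro holds_for_general_tensorI[of f d T0]) auto
qed

section \<open>Linear algebra\<close>

text \<open>Gaussian elimination: an equation with a nonzero coefficient removes itself and one
  unknown, so the surplus of unknowns persists. A solution supported on the multi-indices is itself
  a tensor.\<close>

lemma homogeneous_system_nonzero_solution:
  fixes r :: "'e \<Rightarrow> 'i \<Rightarrow> complex"
  assumes "finite E" "finite U" "card E < card U"
  shows "\<exists>z. z \<noteq> 0 \<and> (\<forall>u. u \<notin> U \<longrightarrow> z u = 0) \<and> (\<forall>e\<in>E. (\<Sum>u\<in>U. r e u * z u) = 0)"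
  using assms
proof (induction E arbitrary: U r rule: finite_induct)
  case empty
  then obtain u where "u \<in> U" by fastforce
  then show ?case by (intro exI[of _ "\<lambda>v. of_bool (v = u)"]) (auto simp: fun_eq_iff)
next
  case (insert e E)
  show ?case
  proof (cases "\<forall>u\<in>U. r e u = 0")
    case True
    obtain z where "z \<noteq> 0" "\<forall>u. u \<notin> U \<longrightarrow> z u = 0" "\<forall>e\<in>E. (\<Sum>u\<in>U. r e u * z u) = 0"
      using insert.IH[of U r] insert.prems insert.hyps by (metis Suc_lessD card_insert_disjoint)
    with True show ?thesis by (intro exI[of _ z]) auto
  next
    case False
    then obtain u0 where u0: "u0 \<in> U" "r e u0 \<noteq> 0" by blast
    define U' where "U' = U - {u0}"
    have U: "U = insert u0 U'" "u0 \<notin> U'" "finite U'"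
      using u0 insert.prems by (auto simp: U'_def)
    have "card E < card U'" using U insert.prems insert.hyps by simp
    from insert.IH[OF U(3) this, of "\<lambda>e' u. r e' u - r e' u0 / r e u0 * r e u"]
    obtain z where z: "z \<noteq> 0" "\<forall>u. u \<notin> U' \<longrightarrow> z u = 0"
      "\<forall>e'\<in>E. (\<Sum>u\<in>U'. (r e' u - r e' u0 / r e u0 * r e u) * z u) = 0" by blast
    define s where "s = (\<Sum>u\<in>U'. r e u * z u)"
    \<comment> \<open>Back substitution: this value at \<open>u0\<close> makes equation
      \<open>e\<close> hold.\<close>
    define z' where "z' = z(u0 := - s / r e u0)"
    have U': "(\<Sum>u\<in>U'. r e' u * z' u) = (\<Sum>u\<in>U'. r e' u * z u)" for e'
      using U by (intro sum.cong) (auto simp: z'_def)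
    have E: "(\<Sum>u\<in>U'. r e' u * z u) = r e' u0 / r e u0 * s" if "e' \<in> E" for e'
      using z(3) that by (auto simp: s_def sum_distrib_left sum_subtractf algebra_simps)
    have "(\<Sum>u\<in>U. r e' u * z' u) = 0" if "e' \<in> insert e E" for e'
      using that u0(2) E U by (auto simp: U' s_def[symmetric]) (auto simp: z'_def)
    moreover have "z' \<noteq> 0"
    proof -
      obtain u where "z u \<noteq> 0" using z(1) by (auto simp: fun_eq_iff)
      then have "z' u \<noteq> 0" using z(2) U by (auto simp: z'_def)
      then show ?thesis by auto
    qed
    moreover have "\<forall>u. u \<notin> U \<longrightarrow> z' u = 0" using z(2) U by (simp add: z'_def)
    ultimately show ?thesis by blast
  qed
qed

text \<open>This turns avoiding a subspace into linear equations: a nonzero vector that vanishes on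
  \<open>P\<close> lies outside the span. Each new generator costs at most one further
  coordinate.\<close>

lemma span_determined_by_coordinates:
  fixes B :: "('i \<Rightarrow> complex) set"
  assumes "finite B"
  shows "\<exists>P. finite P \<and> card P \<le> card B \<and> (\<forall>w\<in>cfun.span B. (\<forall>u\<in>P. w u = 0) \<longrightarrow> w = 0)"
  using assms
proof induction
  case empty
  show ?case by (intro exI[of _ "{}"]) simp
next
  case (insert b B)
  then obtain P where P: "finite P" "card P \<le> card B"
    "\<And>w. w \<in> cfun.span B \<Longrightarrow> \<forall>u\<in>P. w u = 0 \<Longrightarrow> w = 0" by blast
  show ?case
  proof (cases "\<forall>w\<in>cfun.span (insert b B). (\<forall>u\<in>P. w u = 0) \<longrightarrow> w = 0")
    case True
    moreover have "card P \<le> card (insert b B)" using P(2) insert.hyps by simp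
    ultimately show ?thesis using P(1) by blast
  next
    case False
    then obtain w where w: "w \<in> cfun.span (insert b B)" "\<forall>u\<in>P. w u = 0" "w \<noteq> 0" by blast
    then obtain u where u: "w u \<noteq> 0" by (auto simp: fun_eq_iff)
    obtain a where a: "w - cscale a b \<in> cfun.span B" using w(1) cfun.span_breakdown_eq by blast
    have "a \<noteq> 0" using a w P(3)[of w] by (auto simp: cscale_def zero_fun_def[symmetric])
    have "v = 0" if v: "v \<in> cfun.span (insert b B)" "\<forall>u\<in>insert u P. v u = 0" for v
    proof -
      obtain c where c: "v - cscale c b \<in> cfun.span B" using v(1) cfun.span_breakdown_eq by blast
      \<comment> \<open>Subtracting this multiple of \<open>w\<close> cancels \<open>b\<close>. The
        difference lies in the old span and vanishes on \<open>P\<close>, so it is zero, and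
        coordinate \<open>u\<close> then forces \<open>c / a = 0\<close>.\<close>
      have "v - cscale (c / a) w = (v - cscale c b) - cscale (c / a) (w - cscale a b)"
        using \<open>a \<noteq> 0\<close> by (auto simp: fun_eq_iff cscale_def field_simps)
      also have "\<dots> \<in> cfun.span B" by (rule cfun.span_diff[OF c cfun.span_scale[OF a]])
      finally have eq: "v - cscale (c / a) w = 0"
        by (rule P(3)) (use v w in \<open>auto simp: cscale_def\<close>)
      then have "(v - cscale (c / a) w) u = 0" by simp
      then have "c / a = 0" using v u by (auto simp: cscale_def)
      then show "v = 0" using eq by simp
    qed
    moreover have "card (insert u P) \<le> card (insert b B)"
      using P insert.hyps by (simp add: card_insert_if)
    ultimately show ?thesis using P(1) by (intro exI[of _ "insert u P"]) blast
  qed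
qed

text \<open>By induction the functionals in \<open>J\<close> have a dual system in \<open>W\<close>.
  If \<open>L j0\<close> vanished on their common kernel in \<open>W\<close>, it would be a
  combination of them there, against independence.\<close>

lemma independent_functionals_surjective:
  fixes L :: "'j \<Rightarrow> ('i \<Rightarrow> complex) \<Rightarrow> complex"
  assumes "finite J" "cfun.subspace W"
    and "\<And>j. j \<in> J \<Longrightarrow> module_hom cscale (*) (L j)"
    and "\<And>v. (\<And>w. w \<in> W \<Longrightarrow> (\<Sum>j\<in>J. v j * L j w) = 0) \<Longrightarrow> \<forall>j\<in>J. v j = 0"
  shows "\<exists>w\<in>W. \<forall>j\<in>J. L j w = b j"
  using assms(1,3,4)
proof (induction J arbitrary: b rule: finite_induct)
  case empty
  show ?case using cfun.subspace_0[OF assms(2)] by auto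
next
  case (insert j0 J)
  have ind: "\<forall>j\<in>J. v j = 0" if v: "\<And>w. w \<in> W \<Longrightarrow> (\<Sum>j\<in>J. v j * L j w) = 0" for v
  proof -
    have "(\<Sum>j\<in>J. (v(j0 := 0)) j * L j w) = (\<Sum>j\<in>J. v j * L j w)" for w
      using insert.hyps by (intro sum.cong) auto
    then have "(\<Sum>j\<in>insert j0 J. (v(j0 := 0)) j * L j w) = 0" if "w \<in> W" for w
      using v[OF that] insert.hyps by simp
    from insert.prems(2)[OF this] show ?thesis using insert.hyps by (auto split: if_splits)
  qed
  have IH: "\<exists>w\<in>W. \<forall>j\<in>J. L j w = b j" for b
    using insert.prems(1) ind by (intro insert.IH) auto
  have hom: "module_hom cscale (*) (L j)" if "j \<in> insert j0 J" for j
    using insert.prems(1) that .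
  have "\<exists>w\<in>W. (\<forall>j\<in>J. L j w = 0) \<and> L j0 w \<noteq> 0"
  proof (rule ccontr)
    assume "\<not> ?thesis"
    then have none: "L j0 w = 0" if "w \<in> W" "\<forall>j\<in>J. L j w = 0" for w using that by blast
    obtain e where e: "\<And>i. e i \<in> W" "\<And>i j. j \<in> J \<Longrightarrow> L j (e i) = of_bool (j = i)"
      using IH[of "\<lambda>j. of_bool (j = _)"] by metis
    have "(\<Sum>j\<in>insert j0 J. (if j = j0 then -1 else L j0 (e j)) * L j w) = 0" if "w \<in> W" for w
    proof -
      \<comment> \<open>Removing the components of \<open>w\<close> along the dual vectors lands in
        the common kernel, which yields the relation with coefficient \<open>-1\<close> at
        \<open>j0\<close>.\<close>
      define w' where "w' = w - (\<Sum>i\<in>J. cscale (L i w) (e i))"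
      have L: "L j w' = L j w - (\<Sum>i\<in>J. L i w * L j (e i))" if "j \<in> insert j0 J" for j
        unfolding w'_def
        by (simp add: module_hom.diff[OF hom[OF that]] module_hom.sum[OF hom[OF that]]
            module_hom.scale[OF hom[OF that]])
      have "w' \<in> W" unfolding w'_def using \<open>w \<in> W\<close> e(1) assms(2)
        by (intro cfun.subspace_diff cfun.subspace_sum cfun.subspace_scale)
      moreover have "\<forall>j\<in>J. L j w' = 0"
        using insert.hyps(1) by (simp add: L e(2) of_bool_def if_distrib[of "\<lambda>t. _ * t"] cong: if_cong)
      ultimately have "L j0 w' = 0" by (rule none)
      moreover have "(\<Sum>j\<in>J. (if j = j0 then -1 else L j0 (e j)) * L j w) =
          (\<Sum>i\<in>J. L i w * L j0 (e i))"
        using insert.hyps by (intro sum.cong) auto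
      ultimately show ?thesis using insert.hyps by (simp add: L)
    qed
    from insert.prems(2)[OF this] show False by auto
  qed
  then obtain w0 where w0: "w0 \<in> W" "\<forall>j\<in>J. L j w0 = 0" "L j0 w0 \<noteq> 0" by blast
  obtain w where w: "w \<in> W" "\<forall>j\<in>J. L j w = b j" using IH by blast
  \<comment> \<open>Adding a multiple of \<open>w0\<close> adjusts the value at \<open>j0\<close>
    and leaves those at \<open>J\<close> unchanged.\<close>
  define w' where "w' = w + cscale ((b j0 - L j0 w) / L j0 w0) w0"
  have "w' \<in> W" unfolding w'_def using w w0 assms(2)
    by (intro cfun.subspace_add cfun.subspace_scale)
  moreover have "L j w' = L j w + (b j0 - L j0 w) / L j0 w0 * L j w0" if "j \<in> insert j0 J" for j
    unfolding w'_def
    by (simp add: module_hom.add[OF hom[OF that]] module_hom.scale[OF hom[OF that]])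
  ultimately show ?case using w w0 by (intro bexI[of _ w']) auto
qed

section \<open>The critical space\<close>

lemma finite_multi_indices [simp]: "finite (multi_indices d)"
proof (rule finite_subset)
  show "multi_indices d \<subseteq> {I. set I \<subseteq> {..<sum_list d} \<and> length I = length d}"
    by (fastforce simp: multi_indices_def in_set_conv_nth intro: less_le_trans[OF _ elem_le_sum_list])
qed (simp add: finite_lists_length_eq)

lemma multi_indices_update:
  assumes "I \<in> multi_indices d" "q < d ! l"
  shows "I[l := q] \<in> multi_indices d"
  using assms unfolding multi_indices_def
  by (auto, metis nth_list_update_eq nth_list_update_neq)

lemma sum_multi_indices_update:
  fixes f :: "nat list \<Rightarrow> complex"
  assumes "l < length d" "p < d ! l" "q < d ! l"
  shows "(\<Sum>I | I \<in> multi_indices d \<and> I ! l = p. f (I[l := q])) =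
    (\<Sum>I | I \<in> multi_indices d \<and> I ! l = q. f I)"
  using assms
  by (intro sum.reindex_bij_witness[of _ "\<lambda>I. I[l := p]" "\<lambda>I. I[l := q]"])
    (auto simp: multi_indices_update, auto simp: multi_indices_def)

definition critical_form ::
    "nat list \<Rightarrow> (nat list \<Rightarrow> complex) \<Rightarrow> nat \<Rightarrow> nat \<Rightarrow> nat \<Rightarrow> (nat list \<Rightarrow> complex) \<Rightarrow> complex" where
  "critical_form d T l p q z =
    (\<Sum>I | I \<in> multi_indices d \<and> I ! l = p. T I * z (I[l := q]) - T (I[l := q]) * z I)"

lemma critical_space_iff:
  "z \<in> critical_space d T \<longleftrightarrow> z \<in> tensor_space d \<and>
    (\<forall>l<length d. \<forall>p q. p < q \<and> q < d ! l \<longrightarrow> critical_form d T l p q z = 0)"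
  by (auto simp: critical_space_def critical_form_def)

lemma module_hom_critical_form: "module_hom cscale (*) (critical_form d T l p q)"
  by unfold_locales
    (auto simp: critical_form_def cscale_def algebra_simps sum.distrib sum_subtractf sum_distrib_left)

lemma subspace_tensor_space: "cfun.subspace (tensor_space d)"
  by (auto simp: cfun.subspace_def tensor_space_def cscale_def)

lemma subspace_critical_space: "cfun.subspace (critical_space d T)"
  unfolding cfun.subspace_def
  using subspace_tensor_space[of d, unfolded cfun.subspace_def]
  by (auto simp: critical_space_iff module_hom.zero[OF module_hom_critical_form]
      module_hom.add[OF module_hom_critical_form] module_hom.scale[OF module_hom_critical_form])

text \<open>Collects the coefficient of each coordinate of \<open>z\<close>, the shape of equation
  that \<open>homogeneous_system_nonzero_solution\<close> takes.\<close>

lemma critical_form_coefficients: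
  assumes "l < length d" "p < d ! l" "q < d ! l"
  shows "critical_form d T l p q z = (\<Sum>I\<in>multi_indices d.
    ((if I ! l = q then T (I[l := p]) else 0) - (if I ! l = p then T (I[l := q]) else 0)) * z I)"
proof -
  have "(\<Sum>I | I \<in> multi_indices d \<and> I ! l = p. T I * z (I[l := q])) =
      (\<Sum>I | I \<in> multi_indices d \<and> I ! l = p. T (I[l := q, l := p]) * z (I[l := q]))"
    by (intro sum.cong) (auto simp: list_update_id)
  also have "\<dots> = (\<Sum>I | I \<in> multi_indices d \<and> I ! l = q. T (I[l := p]) * z I)"
    by (rule sum_multi_indices_update[OF assms])
  also have "\<dots> = (\<Sum>I\<in>multi_indices d. (if I ! l = q then T (I[l := p]) else 0) * z I)"
    by (subst sum.inter_filter) (auto intro: sum.cong)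
  finally have 1: "(\<Sum>I | I \<in> multi_indices d \<and> I ! l = p. T I * z (I[l := q])) = \<dots>" .
  have 2: "(\<Sum>I | I \<in> multi_indices d \<and> I ! l = p. T (I[l := q]) * z I) =
      (\<Sum>I\<in>multi_indices d. (if I ! l = p then T (I[l := q]) else 0) * z I)"
    by (subst sum.inter_filter) (auto intro: sum.cong)
  show ?thesis
    unfolding critical_form_def by (simp only: sum_subtractf 1 2 left_diff_distrib)
qed

lemma rank_one_tensor_in_tensor_space: "rank_one_tensor d xs \<in> tensor_space d"
  by (simp add: rank_one_tensor_def tensor_space_def)

lemma rank_one_tensor_update:
  assumes "I \<in> multi_indices d" "l < length d" "q < d ! l"
  shows "rank_one_tensor d xs (I[l := q]) =
    (xs ! l) q * (\<Prod>k\<in>{..<length d} - {l}. (xs ! k) (I ! k))"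
proof -
  have len: "length I = length d" using assms(1) by (simp add: multi_indices_def)
  have "rank_one_tensor d xs (I[l := q]) = (\<Prod>k<length d. (xs ! k) (I[l := q] ! k))"
    using multi_indices_update[OF assms(1,3)] by (simp add: rank_one_tensor_def)
  also have "\<dots> = (xs ! l) (I[l := q] ! l) * (\<Prod>k\<in>{..<length d} - {l}. (xs ! k) (I[l := q] ! k))"
    using assms(2) by (intro prod.remove) auto
  also have "\<dots> = (xs ! l) q * (\<Prod>k\<in>{..<length d} - {l}. (xs ! k) (I ! k))"
    using assms(2) len by (intro arg_cong2[of _ _ _ _ "(*)"] prod.cong) auto
  finally show ?thesis .
qed

text \<open>The factor in position \<open>l\<close> comes out of both sums; what remains is a 2 by 2
  minor of the pair formed by the contraction and \<open>xs ! l\<close>.\<close>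

lemma critical_form_rank_one_tensor:
  assumes "l < length d" "p < d ! l" "q < d ! l"
  shows "critical_form d T l p q (rank_one_tensor d xs) =
    contraction d T xs l p * (xs ! l) q - contraction d T xs l q * (xs ! l) p"
proof -
  let ?R = "\<lambda>I. \<Prod>k\<in>{..<length d} - {l}. (xs ! k) (I ! k)"
  have 1: "(\<Sum>I | I \<in> multi_indices d \<and> I ! l = p. T I * rank_one_tensor d xs (I[l := q])) =
      contraction d T xs l p * (xs ! l) q"
    unfolding contraction_def sum_distrib_right
    using assms by (intro sum.cong) (auto simp: rank_one_tensor_update)
  have "(\<Sum>I | I \<in> multi_indices d \<and> I ! l = p. T (I[l := q]) * rank_one_tensor d xs I) =
      (\<Sum>I | I \<in> multi_indices d \<and> I ! l = p. T (I[l := q]) * rank_one_tensor d xs (I[l := q, l := p]))"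
    by (intro sum.cong) (auto simp: list_update_id)
  also have "\<dots> = (\<Sum>I | I \<in> multi_indices d \<and> I ! l = q. T I * rank_one_tensor d xs (I[l := p]))"
    by (rule sum_multi_indices_update[OF assms])
  also have "\<dots> = contraction d T xs l q * (xs ! l) p"
    unfolding contraction_def sum_distrib_right
    using assms by (intro sum.cong) (auto simp: rank_one_tensor_update)
  finally show ?thesis unfolding critical_form_def by (simp only: sum_subtractf 1)
qed

section \<open>Singular vector tuples and the span of their points\<close>

lemma linearly_dependent_pair_minors:
  assumes "linearly_dependent_pair u v"
  shows "u p * v q = u q * v p"
proof -
  obtain a b where ab: "a \<noteq> 0 \<or> b \<noteq> 0" "\<And>i. a * u i + b * v i = 0"
    using assms by (auto simp: linearly_dependent_pair_def cscale_def fun_eq_iff)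
  \<comment> \<open>Both multiples of the minor are combinations of the dependence relations, and
    \<open>a\<close> or \<open>b\<close> can be cancelled.\<close>
  have "a * (u p * v q - u q * v p) = (a * u p + b * v p) * v q - (a * u q + b * v q) * v p"
    "b * (u p * v q - u q * v p) = u p * (a * u q + b * v q) - u q * (a * u p + b * v p)"
    by (simp_all add: algebra_simps)
  then show ?thesis using ab by auto
qed

lemma linearly_dependent_pair_multiple:
  assumes "linearly_dependent_pair u v" "u \<noteq> 0"
  obtains c where "v = cscale c u"
proof -
  obtain i where i: "u i \<noteq> 0" using assms(2) by (auto simp: fun_eq_iff)
  have "v = cscale (v i / u i) u"
    using i linearly_dependent_pair_minors[OF assms(1), of _ i]
    by (auto simp: fun_eq_iff cscale_def field_simps)
  then show thesis by (rule that)
qed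

lemma singular_vector_tuple_critical:
  assumes "singular_vector_tuple d T xs"
  shows "rank_one_tensor d xs \<in> critical_space d T"
  unfolding critical_space_iff
proof (intro conjI allI impI)
  fix l p q assume "l < length d" "p < q \<and> q < d ! l"
  then show "critical_form d T l p q (rank_one_tensor d xs) = 0"
    using linearly_dependent_pair_minors[of "contraction d T xs l" "xs ! l" p q] assms
    by (simp add: critical_form_rank_one_tensor singular_vector_tuple_def)
qed (rule rank_one_tensor_in_tensor_space)

lemma rank_one_tensor_nonzero:
  assumes "\<And>l. l < length d \<Longrightarrow> xs ! l \<in> coord_space (d ! l) \<and> xs ! l \<noteq> 0"
  shows "rank_one_tensor d xs \<noteq> 0"
proof -
  have "\<exists>i. l < length d \<longrightarrow> i < d ! l \<and> (xs ! l) i \<noteq> 0" for l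
    using assms[of l] by (auto simp: coord_space_def fun_eq_iff) (meson not_le)
  then obtain i where i: "\<And>l. l < length d \<Longrightarrow> i l < d ! l \<and> (xs ! l) (i l) \<noteq> 0" by metis
  have "rank_one_tensor d xs (map i [0..<length d]) \<noteq> 0"
    using i by (simp add: rank_one_tensor_def multi_indices_def)
  then show ?thesis by auto
qed

text \<open>The singular points lie in the projectivization of the critical space intersected with
  \<open>W\<close>, which misses the point of \<open>z\<close>.\<close>

lemma proj_span_singular_points_psubset:
  assumes W: "cfun.subspace W" "\<And>xs. singular_vector_tuple d T xs \<Longrightarrow> rank_one_tensor d xs \<in> W"
    and z: "z \<in> critical_space d T" "z \<notin> W"
  shows "proj_span d (singular_points d T) \<subset> projectivization (critical_space d T)"
proof -
  let ?H = "critical_space d T"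
  have sub: "?H \<subseteq> tensor_space d" by (auto simp: critical_space_iff)
  have Z: "singular_points d T \<subseteq> projectivization W'"
    if "\<And>xs. singular_vector_tuple d T xs \<Longrightarrow> rank_one_tensor d xs \<in> W'" for W'
    using that rank_one_tensor_nonzero
    by (fastforce simp: singular_points_def projectivization_def singular_vector_tuple_def)
  have "singular_points d T \<subseteq> projectivization ?H"
    by (rule Z) (rule singular_vector_tuple_critical)
  then have 1: "proj_span d (singular_points d T) \<subseteq> projectivization ?H"
    unfolding proj_span_def using subspace_critical_space sub by blast
  have 2: "proj_point z \<in> projectivization ?H"
    using z W(1) cfun.subspace_0 by (auto simp: projectivization_def)
  have sW: "cfun.subspace (?H \<inter> W)" using subspace_critical_space W(1) by (rule cfun.subspace_inter)
  have "singular_points d T \<subseteq> projectivization (?H \<inter> W)"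
    by (rule Z) (use W(2) singular_vector_tuple_critical in blast)
  then have 3: "proj_span d (singular_points d T) \<subseteq> projectivization (?H \<inter> W)"
    unfolding proj_span_def using sW sub by blast
  have "proj_point z \<notin> projectivization (?H \<inter> W)"
  proof
    assume "proj_point z \<in> projectivization (?H \<inter> W)"
    then obtain w where w: "w \<in> ?H \<inter> W" "cfun.span {z} = cfun.span {w}"
      by (auto simp: projectivization_def proj_point_def)
    have "cfun.span {w} \<subseteq> ?H \<inter> W" using w(1) sW by (intro cfun.span_minimal) auto
    then show False using w(2) cfun.span_base[of z "{z}"] z(2) by auto
  qed
  with 1 2 3 show ?thesis by blast
qed

section \<open>Singular tuples lie on the graph of the last contraction\<close>

text \<open>This is the map \<phi>. The \<open>0\<close> is a placeholder in the position that
  \<open>contraction\<close> leaves out of its product.\<close>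

definition last_contraction ::
    "nat list \<Rightarrow> (nat list \<Rightarrow> complex) \<Rightarrow> (nat \<Rightarrow> complex) list \<Rightarrow> nat \<Rightarrow> complex" where
  "last_contraction d T xs = contraction d T (xs @ [0]) (length xs)"

text \<open>For \<open>xs = [x, y, z]\<close> this is x \<otimes> y \<otimes> z \<otimes> \<phi>(x,
  y, z).\<close>

definition graph_tensor ::
    "nat list \<Rightarrow> (nat list \<Rightarrow> complex) \<Rightarrow> (nat \<Rightarrow> complex) list \<Rightarrow> nat list \<Rightarrow> complex" where
  "graph_tensor d T xs = rank_one_tensor d (xs @ [last_contraction d T xs])"

lemma contraction_snoc:
  assumes "length d = Suc (length xs)"
  shows "contraction d T (xs @ [w]) (length xs) = last_contraction d T xs"
  unfolding last_contraction_def contraction_def using assms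
  by (intro ext sum.cong refl arg_cong2[of _ _ _ _ "(*)"] prod.cong) (auto simp: nth_append)

lemma graph_tensor_in_tensor_space: "graph_tensor d T xs \<in> tensor_space d"
  by (simp add: graph_tensor_def rank_one_tensor_in_tensor_space)

text \<open>The last vector equals its own contraction, so the minor has two equal columns.\<close>

lemma critical_form_last_graph_tensor:
  assumes "length d = Suc (length xs)" "p < d ! length xs" "q < d ! length xs"
  shows "critical_form d T (length xs) p q (graph_tensor d T xs) = 0"
  using assms by (simp add: graph_tensor_def critical_form_rank_one_tensor contraction_snoc)

lemma rank_one_tensor_scale_last:
  assumes "length d = Suc (length xs)"
  shows "rank_one_tensor d (xs @ [cscale c w]) = cscale c (rank_one_tensor d (xs @ [w]))"
proof
  fix I
  have "(\<Prod>l<length xs. ((xs @ [v]) ! l) (I ! l)) = (\<Prod>l<length xs. (xs ! l) (I ! l))" for v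
    by (intro prod.cong) (auto simp: nth_append)
  then show "rank_one_tensor d (xs @ [cscale c w]) I = cscale c (rank_one_tensor d (xs @ [w])) I"
    using assms by (simp add: rank_one_tensor_def cscale_def)
qed

text \<open>Dependence in the last position makes \<open>w\<close> a multiple of the contraction
  once that is nonzero; multilinearity pulls the scalar out.\<close>

lemma singular_vector_tuple_graph_tensor:
  assumes "singular_vector_tuple d T (xs @ [w])" "last_contraction d T xs \<noteq> 0"
  obtains c where "rank_one_tensor d (xs @ [w]) = cscale c (graph_tensor d T xs)"
proof -
  have len: "length d = Suc (length xs)" using assms(1) by (simp add: singular_vector_tuple_def)
  have "linearly_dependent_pair (last_contraction d T xs) w"
    using assms(1) len unfolding singular_vector_tuple_def
    by (metis contraction_snoc lessI nth_append_length)
  then obtain c where "w = cscale c (last_contraction d T xs)"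
    using linearly_dependent_pair_multiple assms(2) by blast
  then show thesis using that[of c] by (simp add: graph_tensor_def rank_one_tensor_scale_last[OF len])
qed

section \<open>Counting dimensions in format \<open>(a, b, c, e)\<close>\<close>

lemma multi_indices_4:
  "I \<in> multi_indices [a, b, c, e] \<longleftrightarrow>
    (\<exists>i j k s. I = [i, j, k, s] \<and> i < a \<and> j < b \<and> k < c \<and> s < e)"
  by (auto simp: multi_indices_def length_Suc_conv less_Suc_eq All_less_Suc2)

lemma card_multi_indices_4: "card (multi_indices [a, b, c, e]) = a * b * c * e"
proof -
  have "bij_betw (\<lambda>(i, j, k, s). [i, j, k, s]) ({..<a} \<times> {..<b} \<times> {..<c} \<times> {..<e})
      (multi_indices [a, b, c, e])"
    by (auto simp: bij_betw_def inj_on_def multi_indices_4 image_iff)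
  from bij_betw_same_card[OF this] show ?thesis by (simp add: mult.assoc)
qed

lemma last_contraction_4:
  assumes "s < e"
  shows "last_contraction [a, b, c, e] T [x, y, z] s =
    (\<Sum>(i, j, k)\<in>{..<a} \<times> {..<b} \<times> {..<c}. T [i, j, k, s] * x i * y j * z k)"
proof -
  have set: "{..<Suc (Suc (Suc (Suc 0)))} - {Suc (Suc (Suc 0))} = {0, 1, 2}" by auto
  show ?thesis
    unfolding last_contraction_def contraction_def using assms
    by (intro sum.reindex_bij_witness[of _ "\<lambda>(i, j, k). [i, j, k, s]" "\<lambda>I. (I ! 0, I ! 1, I ! 2)"])
      (auto simp: multi_indices_4 set mult.assoc)
qed

lemma graph_tensor_4:
  assumes "i < a" "j < b" "k < c" "s < e"
  shows "graph_tensor [a, b, c, e] T [x, y, z] [i, j, k, s] =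
    x i * y j * z k * last_contraction [a, b, c, e] T [x, y, z] s"
  using assms by (simp add: graph_tensor_def rank_one_tensor_def multi_indices_4 numeral_eq_Suc mult.assoc)

lemma sum_fun_apply: "(\<Sum>a\<in>A. f a) x = (\<Sum>a\<in>A. f a x)"
  by (induction A rule: infinite_finite_induct) auto

text \<open>The coordinates of a graph tensor are linear combinations of the monomials of degree
  \<open>(2, 2, 2)\<close> in the three vectors.\<close>

lemma graph_tensors_span:
  "\<exists>B. finite B \<and> card B \<le> (\<Sum>q<a. Suc q) * (\<Sum>q<b. Suc q) * (\<Sum>q<c. Suc q) \<and>
    (\<forall>x y z. graph_tensor [a, b, c, e] T [x, y, z] \<in> cfun.span B)"
proof -
  let ?d = "[a, b, c, e]"
  \<comment> \<open>\<open>S n\<close> encodes the quadratic monomials in \<open>n\<close> variables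
    as pairs of indices, the larger one first.\<close>
  define S where "S n = (SIGMA q:{..<n}. {..q})" for n :: nat
  have S: "finite (S n)" "card (S n) = (\<Sum>q<n. Suc q)" for n by (simp_all add: S_def)
  define K where "K = S a \<times> S b \<times> S c"
  define srt where "srt i j = (max i j, min i j)" for i j :: nat
  have srt: "srt i j \<in> S n" if "i < n" "j < n" for i j n using that by (auto simp: srt_def S_def)
  \<comment> \<open>\<open>key I J\<close> is the monomial to which the term \<open>J\<close> of the
    contraction contributes in coordinate \<open>I\<close>; \<open>g \<kappa>\<close> below is the
    coefficient tensor of the monomial \<open>\<kappa>\<close>.\<close>
  define key where "key I = (\<lambda>(i, j, k). (srt (I ! 0) i, srt (I ! 1) j, srt (I ! 2) k))"
    for I :: "nat list"
  let ?J = "{..<a} \<times> {..<b} \<times> {..<c}"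
  define g where "g \<kappa> I = (\<Sum>J\<in>?J. if I \<in> multi_indices ?d \<and> \<kappa> = key I J
      then (case J of (i, j, k) \<Rightarrow> T [i, j, k, I ! 3]) else 0)" for \<kappa> I
  have "graph_tensor ?d T [x, y, z] = (\<Sum>\<kappa>\<in>K. cscale
      (case \<kappa> of ((i, i'), (j, j'), (k, k')) \<Rightarrow> x i * x i' * (y j * y j') * (z k * z k')) (g \<kappa>))"
    (is "_ = (\<Sum>\<kappa>\<in>K. cscale (?m \<kappa>) (g \<kappa>))") for x y z
  proof
    fix I
    show "graph_tensor ?d T [x, y, z] I = (\<Sum>\<kappa>\<in>K. cscale (?m \<kappa>) (g \<kappa>)) I"
    proof (cases "I \<in> multi_indices ?d")
      case False
      then show ?thesis
        using graph_tensor_in_tensor_space[of ?d T "[x, y, z]"]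
        by (simp add: sum_fun_apply cscale_def g_def tensor_space_def)
    next
      case True
      then obtain i j k s where I: "I = [i, j, k, s]" "i < a" "j < b" "k < c" "s < e"
        by (auto simp: multi_indices_4)
      have m: "?m (key I (i', j', k')) = x i * x i' * (y j * y j') * (z k * z k')" for i' j' k'
        by (auto simp: I key_def srt_def max_def min_def)
      have key: "key I J \<in> K" if "J \<in> ?J" for J
        using that I by (auto simp: key_def K_def srt)
      have "(\<Sum>\<kappa>\<in>K. cscale (?m \<kappa>) (g \<kappa>)) I = (\<Sum>\<kappa>\<in>K. \<Sum>J\<in>?J. if \<kappa> = key I J
          then ?m \<kappa> * (case J of (i, j, k) \<Rightarrow> T [i, j, k, s]) else 0)"
        using True unfolding sum_fun_apply cscale_def g_def sum_distrib_left
        by (intro sum.cong) (auto simp: I(1))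
      also have "\<dots> = (\<Sum>J\<in>?J. \<Sum>\<kappa>\<in>K. if \<kappa> = key I J
          then ?m \<kappa> * (case J of (i, j, k) \<Rightarrow> T [i, j, k, s]) else 0)"
        by (rule sum.swap)
      also have "\<dots> = (\<Sum>J\<in>?J. ?m (key I J) * (case J of (i, j, k) \<Rightarrow> T [i, j, k, s]))"
        using S(1) key by (intro sum.cong refl) (simp add: K_def)
      also have "\<dots> = (\<Sum>(i', j', k')\<in>?J. x i * y j * z k * (T [i', j', k', s] * x i' * y j' * z k'))"
        by (intro sum.cong refl) (clarsimp simp: m simp del: split_paired_All)
      also have "\<dots> = graph_tensor ?d T [x, y, z] I"
        using I by (simp add: graph_tensor_4 last_contraction_4 sum_distrib_left case_prod_unfold)
      finally show ?thesis ..
    qed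
  qed
  then have "graph_tensor ?d T [x, y, z] \<in> cfun.span (g ` K)" for x y z
    by (simp only:) (intro cfun.span_sum cfun.span_scale cfun.span_base imageI)
  moreover have "finite K" "card K = (\<Sum>q<a. Suc q) * (\<Sum>q<b. Suc q) * (\<Sum>q<c. Suc q)"
    by (auto simp: K_def S card_cartesian_product)
  ultimately show ?thesis
    by (intro exI[of _ "g ` K"]) (metis card_image_le finite_imageI)
qed

text \<open>Indexes the critical equations as \<open>(l, q, p)\<close> with \<open>p < q\<close>.
  The last position is left out, because its equations hold on all graph tensors.\<close>

definition critical_pairs :: "nat list \<Rightarrow> (nat \<times> nat \<times> nat) set" where
  "critical_pairs d = (SIGMA l:{..<length d - 1}. SIGMA q:{..<d ! l}. {..<q})"

lemma finite_critical_pairs [simp]: "finite (critical_pairs d)"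
  by (simp add: critical_pairs_def)

text \<open>In \<open>count\<close>, the product bounds the dimension of the graph span and
  \<open>\<Sum>q<e. q\<close> is the number of critical equations of the last position.
  \<open>indep\<close> then lets an element of the graph span correct the other equations.\<close>

lemma critical_space_not_in_graph_span:
  assumes d: "d = [a, b, c, e]"
    and count: "(\<Sum>q<a. Suc q) * (\<Sum>q<b. Suc q) * (\<Sum>q<c. Suc q) + (\<Sum>q<e. q) < a * b * c * e"
    and indep: "\<And>v. (\<And>x y z. (\<Sum>(l, q, p)\<in>critical_pairs d.
        v (l, q, p) * critical_form d T l p q (graph_tensor d T [x, y, z])) = 0) \<Longrightarrow>
      \<forall>j\<in>critical_pairs d. v j = 0"
  shows "\<exists>z\<in>critical_space d T. z \<notin> cfun.span (range (\<lambda>(x, y, z). graph_tensor d T [x, y, z]))"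
proof -
  define W where "W = cfun.span (range (\<lambda>(x, y, z). graph_tensor d T [x, y, z]))"
  obtain B where B: "finite B" "card B \<le> (\<Sum>q<a. Suc q) * (\<Sum>q<b. Suc q) * (\<Sum>q<c. Suc q)"
    "\<forall>x y z. graph_tensor d T [x, y, z] \<in> cfun.span B"
    using graph_tensors_span[of a b c e T] d by blast
  have WB: "W \<subseteq> cfun.span B"
    unfolding W_def using B(3) by (intro cfun.span_minimal) auto
  obtain P where P: "finite P" "card P \<le> card B"
    "\<forall>w\<in>cfun.span B. (\<forall>u\<in>P. w u = 0) \<longrightarrow> w = 0"
    using span_determined_by_coordinates[OF B(1)] by blast
  define Q where "Q = (SIGMA q:{..<e}. {..<q})"
  have Q: "finite Q" "card Q = (\<Sum>q<e. q)" by (simp_all add: Q_def)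
  \<comment> \<open>Two kinds of equations: \<open>Inl u\<close> makes coordinate \<open>u\<close>
    of the solution vanish, \<open>Inr (q, p)\<close> is the critical equation of the last
    position.\<close>
  define r where "r = case_sum (\<lambda>u I. of_bool (I = u)) (\<lambda>(q, p) I.
    (if I ! 3 = q then T (I[3 := p]) else 0) - (if I ! 3 = p then T (I[3 := q]) else 0))"
  have "card (P <+> Q) < card (multi_indices d)"
    using B(2) P(1,2) Q count by (simp add: d card_multi_indices_4 card_Plus)
  then obtain z where z: "z \<noteq> 0" "\<forall>I. I \<notin> multi_indices d \<longrightarrow> z I = 0"
    "\<forall>t\<in>P <+> Q. (\<Sum>I\<in>multi_indices d. r t I * z I) = 0"
    using homogeneous_system_nonzero_solution[of "P <+> Q" "multi_indices d" r] P(1) Q(1) by auto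
  have "z u = 0" if "u \<in> P" for u
  proof (cases "u \<in> multi_indices d")
    case True
    have "(\<Sum>I\<in>multi_indices d. r (Inl u) I * z I) = 0" using z(3) that by blast
    then show ?thesis using True by (simp add: r_def of_bool_def if_distrib[of "\<lambda>t. t * _"] cong: if_cong)
  qed (use z(2) in blast)
  then have zW: "z \<notin> W" using P(3) WB z(1) by blast
  have z3: "critical_form d T 3 p q z = 0" if "p < q" "q < e" for p q
  proof -
    have "Inr (q, p) \<in> P <+> Q" using that by (auto simp: Q_def)
    then have "(\<Sum>I\<in>multi_indices d. r (Inr (q, p)) I * z I) = 0" using z(3) by blast
    then show ?thesis using that by (subst critical_form_coefficients) (auto simp: d r_def)
  qed
  \<comment> \<open>An element of \<open>W\<close> with the same values as \<open>z\<close> under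
    the critical forms of the first three positions; \<open>z - w\<close> is then critical and still
    outside \<open>W\<close>.\<close>
  have "\<exists>w\<in>W. \<forall>j\<in>critical_pairs d.
      (\<lambda>(l, q, p). critical_form d T l p q) j w = (\<lambda>(l, q, p). critical_form d T l p q z) j"
  proof (rule independent_functionals_surjective)
    show "cfun.subspace W" unfolding W_def by (rule cfun.subspace_span)
    fix v assume v: "\<And>w. w \<in> W \<Longrightarrow>
      (\<Sum>j\<in>critical_pairs d. v j * (\<lambda>(l, q, p). critical_form d T l p q) j w) = 0"
    show "\<forall>j\<in>critical_pairs d. v j = 0"
    proof (rule indep)
      fix x y z
      have "graph_tensor d T [x, y, z] \<in> W"
        unfolding W_def by (rule cfun.span_base, rule range_eqI[of _ _ "(x, y, z)"]) simp
      from v[OF this] show "(\<Sum>(l, q, p)\<in>critical_pairs d.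
          v (l, q, p) * critical_form d T l p q (graph_tensor d T [x, y, z])) = 0"
        by (simp add: case_prod_unfold)
    qed
  qed (auto simp: module_hom_critical_form)
  then obtain w where w: "w \<in> W"
    "\<And>l p q. (l, q, p) \<in> critical_pairs d \<Longrightarrow> critical_form d T l p q w = critical_form d T l p q z"
    by fastforce
  have w3: "critical_form d T 3 p q w = 0" if "p < q" "q < e" for p q
    using w(1) unfolding W_def
  proof (induction rule: cfun.span_induct)
    case base
    show ?case
      by (auto simp: cfun.subspace_def module_hom.zero[OF module_hom_critical_form]
          module_hom.add[OF module_hom_critical_form] module_hom.scale[OF module_hom_critical_form])
  next
    case (step u)
    then obtain x y z where "u = graph_tensor d T [x, y, z]" by auto
    then show ?case
      using critical_form_last_graph_tensor[of d "[x, y, z]" p q T] that by (simp add: d numeral_eq_Suc)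
  qed
  have wt: "w \<in> tensor_space d"
    using w(1) cfun.span_minimal[OF _ subspace_tensor_space, of "range (\<lambda>(x, y, z). graph_tensor d T [x, y, z])"]
      graph_tensor_in_tensor_space unfolding W_def by fastforce
  have "z - w \<in> critical_space d T"
    unfolding critical_space_iff
  proof (intro conjI allI impI)
    show "z - w \<in> tensor_space d" using wt z(2) by (simp add: tensor_space_def)
    fix l p q assume l: "l < length d" and pq: "p < q \<and> q < d ! l"
    show "critical_form d T l p q (z - w) = 0"
    proof (cases "l = 3")
      case True
      then show ?thesis using pq z3 w3 by (simp add: module_hom.diff[OF module_hom_critical_form] d)
    next
      case False
      then have "(l, q, p) \<in> critical_pairs d" using l pq by (simp add: critical_pairs_def d)
      then show ?thesis using w(2) by (simp add: module_hom.diff[OF module_hom_critical_form])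
    qed
  qed
  moreover have "z - w \<notin> W"
    using zW w(1) cfun.span_add[of "z - w" _ w] unfolding W_def by fastforce
  ultimately show ?thesis unfolding W_def by blast
qed

section \<open>The last contraction of a general tensor has no zeros\<close>

text \<open>Up to sign, \<open>u\<close> is constant along the antidiagonals of constant
  \<open>k + g\<close>. Those below \<open>N\<close> reach row 0 at a column less than
  \<open>N\<close>, where \<open>first\<close> applies; the others reach row \<open>n\<close> at a
  positive column because \<open>n < N\<close>, where \<open>last\<close> applies.\<close>

lemma shift_relations_zero:
  fixes u :: "nat \<Rightarrow> nat \<Rightarrow> complex"
  assumes "n < N"
    and first: "\<And>g. g < N \<Longrightarrow> u 0 g = 0"
    and rel: "\<And>k g. k < n \<Longrightarrow> g < N \<Longrightarrow> u (Suc k) g + u k (Suc g) = 0"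
    and last: "\<And>g. g < N \<Longrightarrow> u n (Suc g) = 0"
    and "k \<le> n" "g \<le> N"
  shows "u k g = 0"
proof (cases "k + g < N")
  case True
  then show ?thesis using \<open>k \<le> n\<close>
  proof (induction k arbitrary: g)
    case 0
    then show ?case using first by simp
  next
    case (Suc k)
    then show ?case using rel[of k g] by simp
  qed
next
  case False
  \<comment> \<open>Here \<open>j\<close> is the number of steps up to row \<open>n\<close>, and
    \<open>j < g\<close> keeps the column positive on arrival.\<close>
  have "u (n - j) g = 0" if "j \<le> n" "j < g" "g \<le> N" for j g
    using that
  proof (induction j arbitrary: g)
    case 0
    then show ?case using last[of "g - 1"] by simp
  next
    case (Suc j)
    then show ?case using rel[of "n - Suc j" "g - 1"] by (simp add: Suc_diff_Suc)
  qed
  from this[of "n - k" g] show ?thesis using False assms(1,5,6) by simp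
qed

text \<open>The rows express that the functional \<open>v\<close> on forms of degree \<open>(m + 2, m + 1, 1)\<close> kills the
  multiples of the components of the last contraction.\<close>

lemma sum_multiplication_system:
  fixes v :: "nat \<times> nat \<times> nat \<Rightarrow> complex"
  assumes "g \<le> m" "h \<le> Suc m"
  shows "(\<Sum>(k, g', h')\<in>{..m} \<times> {..Suc m} \<times> {..Suc (Suc m)}. v (k, g', h') *
      (\<Sum>i<2. \<Sum>j<2. if g' = g + j \<and> h' = h + i then T [i, j, k, s] else 0)) =
    (\<Sum>k\<le>m. v (k, g, h) * T [0, 0, k, s] + v (k, Suc g, h) * T [0, 1, k, s] +
      v (k, g, Suc h) * T [1, 0, k, s] + v (k, Suc g, Suc h) * T [1, 1, k, s])"
proof -
  \<comment> \<open>The conditions select one term, which is in range since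
    \<open>g \<le> m\<close>, \<open>h \<le> Suc m\<close> and the shifts are at most 1.\<close>
  have delta: "(\<Sum>g'\<le>Suc m. \<Sum>h'\<le>Suc (Suc m). v (k, g', h') *
      (if g' = g + j \<and> h' = h + i then t else 0)) = v (k, g + j, h + i) * t"
    if "i < 2" "j < 2" for k i j t
  proof -
    have "(\<Sum>g'\<le>Suc m. \<Sum>h'\<le>Suc (Suc m). v (k, g', h') *
      (if g' = g + j \<and> h' = h + i then t else 0)) =
      (\<Sum>g'\<le>Suc m. if g' = g + j then (\<Sum>h'\<le>Suc (Suc m). if h' = h + i then v (k, g', h') * t else 0) else 0)"
      by (intro sum.cong refl) (simp add: if_distrib[of "\<lambda>t. _ * t"] del: sum.atMost_Suc cong: if_cong)
    also have "\<dots> = v (k, g + j, h + i) * t"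
      using that assms by (simp del: sum.atMost_Suc)
    finally show ?thesis .
  qed
  have "(\<Sum>(k, g', h')\<in>{..m} \<times> {..Suc m} \<times> {..Suc (Suc m)}. v (k, g', h') *
      (\<Sum>i<2. \<Sum>j<2. if g' = g + j \<and> h' = h + i then T [i, j, k, s] else 0)) =
    (\<Sum>k\<le>m. \<Sum>g'\<le>Suc m. \<Sum>h'\<le>Suc (Suc m). \<Sum>i<2. \<Sum>j<2. v (k, g', h') *
      (if g' = g + j \<and> h' = h + i then T [i, j, k, s] else 0))"
    by (simp only: sum.cartesian_product[symmetric] sum_distrib_left)
  also have "\<dots> = (\<Sum>k\<le>m. \<Sum>i<2. \<Sum>j<2. \<Sum>g'\<le>Suc m. \<Sum>h'\<le>Suc (Suc m). v (k, g', h') *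
      (if g' = g + j \<and> h' = h + i then T [i, j, k, s] else 0))"
    by (simp only: numeral_2_eq_2 sum.lessThan_Suc sum.distrib lessThan_0 sum.empty add_0_left)
  also have "\<dots> = (\<Sum>k\<le>m. \<Sum>i<2. \<Sum>j<2. v (k, g + j, h + i) * T [i, j, k, s])"
    by (intro sum.cong refl delta) auto
  finally show ?thesis by (simp add: numeral_2_eq_2 add.assoc)
qed

text \<open>Its last contraction lists the coefficients of the product of three polynomials in one
  variable of degrees at most 1, 1 and \<open>m\<close>. The product has degree at most
  \<open>m + 2\<close>, so the slice at \<open>m + 3\<close> is zero.\<close>

definition mult_tensor :: "nat \<Rightarrow> nat list \<Rightarrow> complex" where
  "mult_tensor m I = of_bool (I \<in> multi_indices [2, 2, Suc m, m + 4] \<and> I ! 3 = I ! 0 + I ! 1 + I ! 2)"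

text \<open>For the multiplication tensor the functional is annihilated by multiplication with
  \<open>x(t) y(t) z(t)\<close>; the two linear factors are removed one after the other.\<close>

lemma mult_tensor_system:
  fixes v :: "nat \<times> nat \<times> nat \<Rightarrow> complex"
  assumes sys: "\<And>s g h. s < m + 4 \<Longrightarrow> g \<le> m \<Longrightarrow> h \<le> Suc m \<Longrightarrow>
    (\<Sum>k\<le>m. v (k, g, h) * mult_tensor m [0, 0, k, s] + v (k, Suc g, h) * mult_tensor m [0, 1, k, s] +
      v (k, g, Suc h) * mult_tensor m [1, 0, k, s] +
      v (k, Suc g, Suc h) * mult_tensor m [1, 1, k, s]) = 0"
    and "k \<le> m" "g \<le> Suc m" "h \<le> Suc (Suc m)"
  shows "v (k, g, h) = 0"
proof -
  \<comment> \<open>\<open>u\<close> extends \<open>v\<close> by zero beyond \<open>k = m\<close>;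
    \<open>w\<close> and \<open>w2\<close> shift it by one and two in \<open>k\<close>, again padded
    with zero.\<close>
  define u where "u k g h = (if k \<le> m then v (k, g, h) else 0)" for k g h
  define w where "w k g h = (case k of 0 \<Rightarrow> 0 | Suc k' \<Rightarrow> u k' g h)" for k g h
  define w2 where "w2 k g h = (case k of 0 \<Rightarrow> 0 | Suc k' \<Rightarrow> w k' g h)" for k g h
  have M: "mult_tensor m [i, j, k, s] = of_bool (s = i + j + k)"
    if "i < 2" "j < 2" "k \<le> m" "s < m + 4" for i j k s
    using that by (auto simp: mult_tensor_def multi_indices_4)
  have U: "(\<Sum>k\<le>m. v (k, g, h) * of_bool (s = k)) = u s g h" for g h s
    by (simp add: u_def of_bool_def if_distrib[of "\<lambda>t. _ * t"] cong: if_cong)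
  have U1: "(\<Sum>k\<le>m. v (k, g, h) * of_bool (s = Suc k)) = w s g h" for g h s
    using U[where s = "s - 1"] by (cases s) (simp_all add: w_def)
  have U2: "(\<Sum>k\<le>m. v (k, g, h) * of_bool (s = Suc (Suc k))) = w2 s g h" for g h s
    using U1[where s = "s - 1"] by (cases s) (simp_all add: w2_def)
  \<comment> \<open>The four terms factor: the operator adding a shifted copy with
    \<open>Suc g\<close>, composed with the one for \<open>Suc h\<close>, kills
    \<open>u\<close>.\<close>
  have eq: "u s g h + w s (Suc g) h + w s g (Suc h) + w2 s (Suc g) (Suc h) = 0"
    if "s < m + 4" "g \<le> m" "h \<le> Suc m" for s g h
  proof -
    have "0 = (\<Sum>k\<le>m. v (k, g, h) * of_bool (s = k) + v (k, Suc g, h) * of_bool (s = Suc k) +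
      v (k, g, Suc h) * of_bool (s = Suc k) + v (k, Suc g, Suc h) * of_bool (s = Suc (Suc k)))"
      unfolding sys[OF that, symmetric] using that(1) by (intro sum.cong refl) (simp add: M)
    then show ?thesis by (simp add: sum.distrib U U1 U2)
  qed
  \<comment> \<open>The factor in \<open>h\<close> goes first. The remaining expression has one more
    row than \<open>u\<close>, hence the bounds \<open>Suc m\<close> and
    \<open>Suc (Suc m)\<close>.\<close>
  have p: "u k g h + w k (Suc g) h = 0" if g: "g \<le> m" and "k \<le> Suc m" "h \<le> Suc (Suc m)" for k g h
  proof (rule shift_relations_zero[where u = "\<lambda>k h. u k g h + w k (Suc g) h"])
    show "Suc m < Suc (Suc m)" by simp
    show "u 0 g h + w 0 (Suc g) h = 0" if "h < Suc (Suc m)" for h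
      using eq[of 0 g h] g that by (simp add: w_def w2_def)
    show "u (Suc k) g h + w (Suc k) (Suc g) h + (u k g (Suc h) + w k (Suc g) (Suc h)) = 0"
      if "k < Suc m" "h < Suc (Suc m)" for k h
      using eq[of "Suc k" g h] g that by (simp add: w_def w2_def add.assoc)
    show "u (Suc m) g (Suc h) + w (Suc m) (Suc g) (Suc h) = 0" if "h < Suc (Suc m)" for h
      using eq[of "Suc (Suc m)" g h] g that by (simp add: w_def w2_def u_def)
  qed (use that in auto)
  have "u k g h = 0"
  proof (rule shift_relations_zero[where u = "\<lambda>k g. u k g h"])
    show "m < Suc m" by simp
    show "u 0 g h = 0" if "g < Suc m" for g
      using p[of g 0 h] that assms(4) by (simp add: w_def)
    show "u (Suc k) g h + u k (Suc g) h = 0" if "k < m" "g < Suc m" for k g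
      using p[of g "Suc k" h] that assms(4) by (simp add: w_def)
    show "u m (Suc g) h = 0" if "g < Suc m" for g
      using p[of g "Suc m" h] that assms(4) by (simp add: w_def u_def)
  qed (use assms in auto)
  then show ?thesis using assms by (simp add: u_def)
qed

text \<open>At a zero of the last contraction, evaluating the forms of degree
  \<open>(m + 2, m + 1, 1)\<close> gives a nonzero functional that kills all multiples of its
  components. The system excludes this for general tensors, since it is injective at
  \<open>mult_tensor m\<close>.\<close>

lemma general_last_contraction_nonzero:
  defines "d \<equiv> \<lambda>m. [2, 2, Suc m, m + 4]"
  shows "holds_for_general_tensor (d m) (\<lambda>T. \<forall>x y z.
    x \<in> coord_space 2 \<longrightarrow> y \<in> coord_space 2 \<longrightarrow> z \<in> coord_space (Suc m) \<longrightarrow>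
    x \<noteq> 0 \<longrightarrow> y \<noteq> 0 \<longrightarrow> z \<noteq> 0 \<longrightarrow> last_contraction (d m) T [x, y, z] \<noteq> 0)"
proof -
  define C where "C = {..m} \<times> {..Suc m} \<times> {..Suc (Suc m)}"
  define R where "R = {..<m + 4} \<times> {..m} \<times> {..Suc m}"
  define A :: "nat \<times> nat \<times> nat \<Rightarrow> nat \<times> nat \<times> nat \<Rightarrow> (nat list \<Rightarrow> complex) \<Rightarrow> complex"
    where "A = (\<lambda>(s, g, h) (k, g', h') T.
      (\<Sum>i<2. \<Sum>j<2. if g' = g + j \<and> h' = h + i then T [i, j, k, s] else 0))"
  have sum: "(\<Sum>c\<in>C. v c * A (s, g, h) c T) =
      (\<Sum>k\<le>m. v (k, g, h) * T [0, 0, k, s] + v (k, Suc g, h) * T [0, 1, k, s] +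
      v (k, g, Suc h) * T [1, 0, k, s] + v (k, Suc g, Suc h) * T [1, 1, k, s])"
    if "(s, g, h) \<in> R" for v s g h T
  proof -
    have "(\<Sum>c\<in>C. v c * A (s, g, h) c T) = (\<Sum>(k, g', h')\<in>C. v (k, g', h') *
        (\<Sum>i<2. \<Sum>j<2. if g' = g + j \<and> h' = h + i then T [i, j, k, s] else 0))"
      by (intro sum.cong refl) (auto simp: A_def)
    then show ?thesis using that sum_multiplication_system[of g m h v T s] by (simp add: C_def R_def)
  qed
  have gen: "holds_for_general_tensor (d m)
    (\<lambda>T. \<forall>v. (\<forall>r\<in>R. (\<Sum>c\<in>C. v c * A r c T) = 0) \<longrightarrow> (\<forall>c\<in>C. v c = 0))"
  proof (rule holds_for_general_tensor_injective_system)
    show "finite C" by (simp add: C_def)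
    show "mult_tensor m \<in> tensor_space (d m)"
      by (simp add: tensor_space_def mult_tensor_def d_def)
    show "A r c \<in> polynomial_functions (d m)" if "r \<in> R" "c \<in> C" for r c
    proof -
      obtain s g h k g' h' where rc: "r = (s, g, h)" "c = (k, g', h')" by (metis prod_cases3)
      have "(\<lambda>T. \<Sum>i<2. \<Sum>j<2. if g' = g + j \<and> h' = h + i then T [i, j, k, s] else 0)
          \<in> polynomial_functions (d m)"
        using that
        by (intro polynomial_functions_sum polynomial_functions_if polynomial_functions.const
            polynomial_functions.coord) (auto simp: rc R_def C_def d_def multi_indices_4)
      then show ?thesis by (simp add: A_def rc)
    qed
    fix v assume v: "\<And>r. r \<in> R \<Longrightarrow> (\<Sum>c\<in>C. v c * A r c (mult_tensor m)) = 0"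
    have "v (k, g, h) = 0" if "k \<le> m" "g \<le> Suc m" "h \<le> Suc (Suc m)" for k g h
    proof (rule mult_tensor_system[OF _ that])
      fix s g h assume "s < m + 4" "g \<le> m" "h \<le> Suc m"
      then have "(s, g, h) \<in> R" by (simp add: R_def)
      from v[OF this] sum[OF this, of v "mult_tensor m"]
      show "(\<Sum>k\<le>m. v (k, g, h) * mult_tensor m [0, 0, k, s] + v (k, Suc g, h) * mult_tensor m [0, 1, k, s] +
          v (k, g, Suc h) * mult_tensor m [1, 0, k, s] +
          v (k, Suc g, Suc h) * mult_tensor m [1, 1, k, s]) = 0" by simp
    qed
    then show "\<forall>c\<in>C. v c = 0" by (auto simp: C_def)
  qed
  have "last_contraction (d m) T [x, y, z] \<noteq> 0"
    if T: "\<forall>v. (\<forall>r\<in>R. (\<Sum>c\<in>C. v c * A r c T) = 0) \<longrightarrow> (\<forall>c\<in>C. v c = 0)"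
      and x: "x \<in> coord_space 2" "x \<noteq> 0" and y: "y \<in> coord_space 2" "y \<noteq> 0"
      and z: "z \<in> coord_space (Suc m)" "z \<noteq> 0" for T x y z
  proof
    assume zero: "last_contraction (d m) T [x, y, z] = 0"
    \<comment> \<open>The values of the monomials at the supposed zero.\<close>
    define v where "v = (\<lambda>(k, g, h). z k * (y 0 ^ (Suc m - g) * y 1 ^ g) *
        (x 0 ^ (Suc (Suc m) - h) * x 1 ^ h))"
    have "(\<Sum>c\<in>C. v c * A r c T) = 0" if r: "r \<in> R" for r
    proof -
      obtain s g h where r_eq: "r = (s, g, h)" by (metis prod_cases3)
      with r have sgh: "s < m + 4" "g \<le> m" "h \<le> Suc m" by (auto simp: R_def)
      \<comment> \<open>The monomial of degree \<open>m + 1\<close> in \<open>x\<close> and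
        \<open>m\<close> in \<open>y\<close> that multiplies component \<open>s\<close>.\<close>
      let ?c = "y 0 ^ (m - g) * y 1 ^ g * (x 0 ^ (Suc m - h) * x 1 ^ h)"
      have "(\<Sum>c\<in>C. v c * A r c T) =
        (\<Sum>k\<le>m. v (k, g, h) * T [0, 0, k, s] + v (k, Suc g, h) * T [0, 1, k, s] +
        v (k, g, Suc h) * T [1, 0, k, s] + v (k, Suc g, Suc h) * T [1, 1, k, s])"
        using sum r r_eq by simp
      also have "\<dots> = (\<Sum>k\<le>m. ?c * (T [0, 0, k, s] * x 0 * y 0 * z k + T [0, 1, k, s] * x 0 * y 1 * z k +
         T [1, 0, k, s] * x 1 * y 0 * z k + T [1, 1, k, s] * x 1 * y 1 * z k))"
        using sgh by (intro sum.cong refl) (simp add: v_def Suc_diff_le algebra_simps)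
      also have "\<dots> = ?c * last_contraction (d m) T [x, y, z] s"
        using sgh(1) unfolding d_def
        by (simp add: last_contraction_4 sum.cartesian_product[symmetric] sum_distrib_left[symmetric]
            numeral_2_eq_2 sum.distrib lessThan_Suc_atMost add.assoc)
      finally show ?thesis by (simp add: zero)
    qed
    with T have v0: "\<forall>c\<in>C. v c = 0" by blast
    obtain k where k: "k \<le> m" "z k \<noteq> 0"
      using z by (auto simp: coord_space_def fun_eq_iff) (metis not_less_eq_eq)
    have xy: "x 0 \<noteq> 0 \<or> x 1 \<noteq> 0" "y 0 \<noteq> 0 \<or> y 1 \<noteq> 0"
      using x y by (auto simp: coord_space_def fun_eq_iff)
        (metis One_nat_def less_2_cases not_less)+
    \<comment> \<open>These exponents select pure powers of nonzero coordinates of \<open>y\<close>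
      and \<open>x\<close>.\<close>
    define g where "g = (if y 0 = 0 then Suc m else 0)"
    define h where "h = (if x 0 = 0 then Suc (Suc m) else 0)"
    have "v (k, g, h) \<noteq> 0" using k xy by (auto simp: v_def g_def h_def)
    moreover have "(k, g, h) \<in> C" using k by (auto simp: C_def g_def h_def)
    ultimately show False using v0 by blast
  qed
  then show ?thesis by (intro holds_for_general_tensor_mono[OF gen]) blast
qed

section \<open>Independence of the critical equations on the graph\<close>

text \<open>\<open>T\<close> enters twice, in the critical form and in the last vector of the graph
  tensor, each time linearly.\<close>

lemma polynomial_critical_form_graph_tensor:
  assumes "length d = Suc (length xs)" "q < d ! l"
  shows "(\<lambda>T. critical_form d T l p q (graph_tensor d T xs)) \<in> polynomial_functions d"
proof -
  have lc: "(\<lambda>T. last_contraction d T xs s) \<in> polynomial_functions d" for s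
    unfolding last_contraction_def contraction_def
    by (intro polynomial_functions_sum polynomial_functions.mult polynomial_functions.const
        polynomial_functions.coord) auto
  have "graph_tensor d T xs I = (if I \<in> multi_indices d then
      (\<Prod>l<length xs. (xs ! l) (I ! l)) * last_contraction d T xs (I ! length xs) else 0)" for T I
  proof -
    have "(\<Prod>l<length xs. ((xs @ [w]) ! l) (I ! l)) = (\<Prod>l<length xs. (xs ! l) (I ! l))" for w
      by (intro prod.cong) (auto simp: nth_append)
    then show ?thesis using assms(1) by (simp add: graph_tensor_def rank_one_tensor_def)
  qed
  then have gt: "(\<lambda>T. graph_tensor d T xs I) \<in> polynomial_functions d" for I
    by (simp only:) (intro polynomial_functions_if polynomial_functions.mult
        polynomial_functions.const lc)
  show ?thesis
    unfolding critical_form_def using assms(2)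
    by (intro polynomial_functions_sum polynomial_functions_diff polynomial_functions.mult gt
        polynomial_functions.coord) (auto intro: multi_indices_update)
qed

text \<open>The only nonzero slice, at \<open>m + 3\<close>, carries the trilinear form \<open>x 0 *
  y 0 * z 0 + 2 * x 0 * y 1 * z 1 + 3 * x 1 * y 0 * z 2 + 4 * x 1 * y 1 * z 3\<close>, without the
  terms whose index in \<open>z\<close> exceeds \<open>m\<close>. The unequal weights keep the
  equations for the unknowns nondegenerate.\<close>

definition slice_tensor :: "nat \<Rightarrow> nat list \<Rightarrow> complex" where
  "slice_tensor m I = (if I \<in> multi_indices [2, 2, Suc m, m + 4] \<and> I ! 3 = m + 3 \<and>
     I ! 2 = 2 * I ! 0 + I ! 1 then of_nat (Suc (I ! 2)) else 0)"

lemma contraction_4: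
  "p < a \<Longrightarrow> contraction [a, b, c, e] T [x, y, z, w] 0 p =
    (\<Sum>j<b. \<Sum>k<c. \<Sum>s<e. T [p, j, k, s] * (y j * z k * w s))"
  "p < b \<Longrightarrow> contraction [a, b, c, e] T [x, y, z, w] 1 p =
    (\<Sum>i<a. \<Sum>k<c. \<Sum>s<e. T [i, p, k, s] * (x i * z k * w s))"
  "p < c \<Longrightarrow> contraction [a, b, c, e] T [x, y, z, w] 2 p =
    (\<Sum>i<a. \<Sum>j<b. \<Sum>s<e. T [i, j, p, s] * (x i * y j * w s))"
proof -
  have set: "{..<Suc (Suc (Suc (Suc 0)))} - {0} = {1, 2, 3}"
    "{..<Suc (Suc (Suc (Suc 0)))} - {Suc 0} = {0, 2, 3}"
    "{..<Suc (Suc (Suc (Suc 0)))} - {2} = {0, 1, 3}" by auto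
  show "contraction [a, b, c, e] T [x, y, z, w] 0 p =
      (\<Sum>j<b. \<Sum>k<c. \<Sum>s<e. T [p, j, k, s] * (y j * z k * w s))" if "p < a"
    unfolding contraction_def sum.cartesian_product using that
    by (intro sum.reindex_bij_witness[of _ "\<lambda>(j, k, s). [p, j, k, s]" "\<lambda>I. (I ! 1, I ! 2, I ! 3)"])
      (auto simp: multi_indices_4 set mult.assoc)
  show "contraction [a, b, c, e] T [x, y, z, w] 1 p =
      (\<Sum>i<a. \<Sum>k<c. \<Sum>s<e. T [i, p, k, s] * (x i * z k * w s))" if "p < b"
    unfolding contraction_def sum.cartesian_product using that
    by (intro sum.reindex_bij_witness[of _ "\<lambda>(i, k, s). [i, p, k, s]" "\<lambda>I. (I ! 0, I ! 2, I ! 3)"])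
      (auto simp: multi_indices_4 set mult.assoc)
  show "contraction [a, b, c, e] T [x, y, z, w] 2 p =
      (\<Sum>i<a. \<Sum>j<b. \<Sum>s<e. T [i, j, p, s] * (x i * y j * w s))" if "p < c"
    unfolding contraction_def sum.cartesian_product using that
    by (intro sum.reindex_bij_witness[of _ "\<lambda>(i, j, s). [i, j, p, s]" "\<lambda>I. (I ! 0, I ! 1, I ! 3)"])
      (auto simp: multi_indices_4 set mult.assoc)
qed

lemma slice_tensor_eq:
  assumes "i < 2" "j < 2" "k < Suc m" "s < m + 4"
  shows "slice_tensor m [i, j, k, s] =
    (if s = m + 3 then if k = 2 * i + j then of_nat (Suc k) else 0 else 0)"
  using assms by (auto simp: slice_tensor_def multi_indices_4)

lemma sum_slice_tensor:
  assumes "i < 2" "j < 2" "k < Suc m"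
  shows "(\<Sum>s<m + 4. slice_tensor m [i, j, k, s] * (t * w s)) =
    (if k = 2 * i + j then of_nat (Suc k) * (t * w (m + 3)) else 0)"
proof -
  have "(\<Sum>s<m + 4. slice_tensor m [i, j, k, s] * (t * w s)) = (\<Sum>s<m + 4. if s = m + 3 then
      (if k = 2 * i + j then of_nat (Suc k) * (t * w (m + 3)) else 0) else 0)"
    using assms by (intro sum.cong refl) (auto simp: slice_tensor_eq)
  then show ?thesis by simp
qed

text \<open>These are \<open>w (m + 3)\<close> times the partial derivatives of the trilinear form.
  Entries of \<open>z\<close> beyond \<open>m\<close> vanish, so the same formulas serve every
  \<open>m\<close>.\<close>

lemma contraction_slice_tensor:
  fixes m :: nat and x y z w :: "nat \<Rightarrow> complex"
  defines "D \<equiv> \<lambda>l p. contraction [2, 2, Suc m, m + 4] (slice_tensor m) [x, y, z, w] l p"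
  assumes z: "z \<in> coord_space (Suc m)"
  shows "D 0 0 = w (m + 3) * (y 0 * z 0 + 2 * y 1 * z 1)"
    "D 0 1 = w (m + 3) * (3 * y 0 * z 2 + 4 * y 1 * z 3)"
    "D 1 0 = w (m + 3) * (x 0 * z 0 + 3 * x 1 * z 2)"
    "D 1 1 = w (m + 3) * (2 * x 0 * z 1 + 4 * x 1 * z 3)"
    "\<And>p. p < Suc m \<Longrightarrow> p < 4 \<Longrightarrow> D 2 p = w (m + 3) * (of_nat (Suc p) * x (p div 2) * y (p mod 2))"
proof -
  have z0: "z k = 0" if "\<not> k < Suc m" for k using z that by (simp add: coord_space_def)
  have delta: "(\<Sum>k<Suc m. \<Sum>s<m + 4. slice_tensor m [i, j, k, s] * (t * z k * w s)) =
      of_nat (Suc (2 * i + j)) * (t * z (2 * i + j) * w (m + 3))" if "i < 2" "j < 2" for i j t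
  proof -
    have "(\<Sum>k<Suc m. \<Sum>s<m + 4. slice_tensor m [i, j, k, s] * (t * z k * w s)) =
        (\<Sum>k<Suc m. if k = 2 * i + j then of_nat (Suc k) * (t * z k * w (m + 3)) else 0)"
      using that by (intro sum.cong refl sum_slice_tensor) auto
    then show ?thesis using z0[of "2 * i + j"] by (auto simp del: sum.lessThan_Suc)
  qed
  have D0: "D 0 p = (\<Sum>j<2. of_nat (Suc (2 * p + j)) * (y j * z (2 * p + j) * w (m + 3)))" if "p < 2" for p
    unfolding D_def contraction_4(1)[OF that]
    by (intro sum.cong refl delta) (use that in auto)
  have D1: "D 1 p = (\<Sum>i<2. of_nat (Suc (2 * i + p)) * (x i * z (2 * i + p) * w (m + 3)))" if "p < 2" for p
    unfolding D_def contraction_4(2)[OF that]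
    by (intro sum.cong refl delta) (use that in auto)
  have D2: "D 2 p = (\<Sum>i<2. \<Sum>j<2. if p = 2 * i + j then of_nat (Suc p) * (x i * y j * w (m + 3)) else 0)"
    if "p < Suc m" for p
    unfolding D_def contraction_4(3)[OF that]
    by (intro sum.cong refl sum_slice_tensor) (use that in auto)
  show "D 0 0 = w (m + 3) * (y 0 * z 0 + 2 * y 1 * z 1)"
    "D 0 1 = w (m + 3) * (3 * y 0 * z 2 + 4 * y 1 * z 3)"
    using D0[of 0] D0[of 1] by (simp_all add: numeral_eq_Suc algebra_simps)
  show "D 1 0 = w (m + 3) * (x 0 * z 0 + 3 * x 1 * z 2)"
    "D 1 1 = w (m + 3) * (2 * x 0 * z 1 + 4 * x 1 * z 3)"
    using D1[of 0] D1[of 1] by (simp_all add: numeral_eq_Suc algebra_simps)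
  fix p :: nat assume p: "p < Suc m" "p < 4"
  then have "p = 0 \<or> p = 1 \<or> p = 2 \<or> p = 3" by linarith
  moreover have "(\<Sum>i<2. f i) = f 0 + f 1" for f :: "nat \<Rightarrow> complex" by (simp add: numeral_2_eq_2)
  ultimately show "D 2 p = w (m + 3) * (of_nat (Suc p) * x (p div 2) * y (p mod 2))"
    unfolding D2[OF p(1)] by (elim disjE) simp_all
qed

lemma last_contraction_slice_tensor:
  assumes z: "z \<in> coord_space (Suc m)"
  shows "last_contraction [2, 2, Suc m, m + 4] (slice_tensor m) [x, y, z] (m + 3) =
    x 0 * y 0 * z 0 + 2 * x 0 * y 1 * z 1 + 3 * x 1 * y 0 * z 2 + 4 * x 1 * y 1 * z 3"
proof -
  have z0: "z k = 0" if "\<not> k < Suc m" for k using z that by (simp add: coord_space_def)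
  have "(\<Sum>k<Suc m. slice_tensor m [i, j, k, m + 3] * x i * y j * z k) =
      of_nat (Suc (2 * i + j)) * x i * y j * z (2 * i + j)" if "i < 2" "j < 2" for i j
  proof -
    have "(\<Sum>k<Suc m. slice_tensor m [i, j, k, m + 3] * x i * y j * z k) =
      (\<Sum>k<Suc m. if k = 2 * i + j then of_nat (Suc k) * x i * y j * z k else 0)"
      using that by (intro sum.cong refl) (auto simp: slice_tensor_eq)
    then show ?thesis using z0[of "2 * i + j"] by (auto simp del: sum.lessThan_Suc)
  qed
  then have "last_contraction [2, 2, Suc m, m + 4] (slice_tensor m) [x, y, z] (m + 3) =
      (\<Sum>i<2. \<Sum>j<2. of_nat (Suc (2 * i + j)) * x i * y j * z (2 * i + j))"
    by (simp add: last_contraction_4 sum.cartesian_product[symmetric] del: sum.lessThan_Suc)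
  then show ?thesis by (simp add: numeral_eq_Suc algebra_simps)
qed

lemma sum_critical_pairs_4:
  fixes F :: "nat \<Rightarrow> nat \<Rightarrow> nat \<Rightarrow> complex"
  shows "(\<Sum>(l, q, p)\<in>critical_pairs [2, 2, c, e]. F l q p) =
    F 0 1 0 + F 1 1 0 + (\<Sum>q<c. \<Sum>p<q. F 2 q p)"
  by (simp add: critical_pairs_def sum.Sigma[symmetric] numeral_eq_Suc)

text \<open>All critical forms of the graph tensor share the factor \<open>w (m + 3)\<close>, the
  value of the trilinear form, which \<open>nz\<close> allows to be cancelled.\<close>

lemma slice_tensor_relation:
  fixes m :: nat and v :: "nat \<times> nat \<times> nat \<Rightarrow> complex" and x y z :: "nat \<Rightarrow> complex"
  defines "d \<equiv> [2, 2, Suc m, m + 4]"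
  assumes m: "m \<le> 3"
    and v: "(\<Sum>(l, q, p)\<in>critical_pairs d. v (l, q, p) *
      critical_form d (slice_tensor m) l p q (graph_tensor d (slice_tensor m) [x, y, z])) = 0"
    and z: "z \<in> coord_space (Suc m)"
    and nz: "x 0 * y 0 * z 0 + 2 * x 0 * y 1 * z 1 + 3 * x 1 * y 0 * z 2 + 4 * x 1 * y 1 * z 3 \<noteq> 0"
  shows "v (0, 1, 0) * ((y 0 * z 0 + 2 * y 1 * z 1) * x 1 - (3 * y 0 * z 2 + 4 * y 1 * z 3) * x 0) +
      v (1, 1, 0) * ((x 0 * z 0 + 3 * x 1 * z 2) * y 1 - (2 * x 0 * z 1 + 4 * x 1 * z 3) * y 0) +
      (\<Sum>q<Suc m. \<Sum>p<q. v (2, q, p) * (of_nat (Suc p) * x (p div 2) * y (p mod 2) * z q -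
        of_nat (Suc q) * x (q div 2) * y (q mod 2) * z p)) = 0" (is "?S = 0")
proof -
  define w where "w = last_contraction d (slice_tensor m) [x, y, z]"
  have w: "w (m + 3) \<noteq> 0" using nz unfolding w_def d_def last_contraction_slice_tensor[OF z] .
  have F: "critical_form d (slice_tensor m) l p q (graph_tensor d (slice_tensor m) [x, y, z]) =
      contraction d (slice_tensor m) [x, y, z, w] l p * ([x, y, z, w] ! l) q -
      contraction d (slice_tensor m) [x, y, z, w] l q * ([x, y, z, w] ! l) p"
    if "l < length d" "p < q" "q < d ! l" for l p q
    using that by (simp add: graph_tensor_def w_def critical_form_rank_one_tensor)
  note D = contraction_slice_tensor[OF z, folded d_def]
  have F0: "critical_form d (slice_tensor m) 0 0 1 (graph_tensor d (slice_tensor m) [x, y, z]) =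
      w (m + 3) * ((y 0 * z 0 + 2 * y 1 * z 1) * x 1 - (3 * y 0 * z 2 + 4 * y 1 * z 3) * x 0)"
    by (subst F) (simp_all only: D, simp_all add: d_def algebra_simps)
  have F1: "critical_form d (slice_tensor m) 1 0 1 (graph_tensor d (slice_tensor m) [x, y, z]) =
      w (m + 3) * ((x 0 * z 0 + 3 * x 1 * z 2) * y 1 - (2 * x 0 * z 1 + 4 * x 1 * z 3) * y 0)"
    by (subst F) (simp_all only: D, simp_all add: d_def algebra_simps)
  have F2: "critical_form d (slice_tensor m) 2 p q (graph_tensor d (slice_tensor m) [x, y, z]) =
      w (m + 3) * (of_nat (Suc p) * x (p div 2) * y (p mod 2) * z q -
        of_nat (Suc q) * x (q div 2) * y (q mod 2) * z p)" if "p < q" "q < Suc m" for p q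
  proof -
    have "p < Suc m" "p < 4" "q < 4" using that m by auto
    then show ?thesis
      by (subst F) (use that in \<open>simp_all only: D\<close>, simp_all add: d_def that algebra_simps)
  qed
  have "w (m + 3) * ?S = (\<Sum>(l, q, p)\<in>critical_pairs d. v (l, q, p) *
      critical_form d (slice_tensor m) l p q (graph_tensor d (slice_tensor m) [x, y, z]))"
    unfolding d_def sum_critical_pairs_4 unfolding d_def[symmetric] F0 F1 distrib_left sum_distrib_left
    by (intro arg_cong2[of _ _ _ _ "(+)"] sum.cong refl) (simp_all add: F2)
  then show ?thesis using w v by simp
qed

text \<open>At vectors with few nonzero coordinates almost all minors vanish, so the unknowns can be
  eliminated in small groups.\<close>

lemma slice_tensor_independent:
  fixes m :: nat and v :: "nat \<times> nat \<times> nat \<Rightarrow> complex"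
  defines "d \<equiv> [2, 2, Suc m, m + 4]"
  assumes m: "m = 1 \<or> m = 2 \<or> m = 3"
    and v: "\<And>x y z. (\<Sum>(l, q, p)\<in>critical_pairs d. v (l, q, p) *
      critical_form d (slice_tensor m) l p q (graph_tensor d (slice_tensor m) [x, y, z])) = 0"
  shows "\<forall>j\<in>critical_pairs d. v j = 0"
proof -
  define \<delta> :: "nat \<Rightarrow> nat \<Rightarrow> complex" where "\<delta> i k = of_bool (k = i)" for i k
  have "m \<le> 3" using m by auto
  \<comment> \<open>The vectors are instantiated below in the order \<open>z\<close>,
    \<open>x\<close>, \<open>y\<close>, that of their first occurrence in the premises of
    \<open>rel\<close>.\<close>
  note rel = slice_tensor_relation[OF this v[unfolded d_def]]
  \<comment> \<open>Points where the cubic form of the slice does not vanish; each yields an equation in one or two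
    of the unknowns.\<close>
  note X1 = rel[of "\<delta> 0" "\<lambda>k. \<delta> 0 k + \<delta> 1 k" "\<delta> 0"]
   and X2 = rel[of "\<lambda>k. \<delta> 0 k + \<delta> 2 k" "\<delta> 0" "\<delta> 0"]
   and X3 = rel[of "\<delta> 0" "\<delta> 0" "\<lambda>k. \<delta> 0 k + \<delta> 1 k"]
   and X4 = rel[of "\<lambda>k. \<delta> 0 k + \<delta> 1 k" "\<delta> 0" "\<delta> 0"]
   and X5 = rel[of "\<lambda>k. \<delta> 1 k + \<delta> 2 k" "\<delta> 0" "\<delta> 1"]
   and X6 = rel[of "\<lambda>k. \<delta> 0 k + \<delta> 3 k" "\<delta> 0" "\<delta> 0"]
   and X7 = rel[of "\<lambda>k. \<delta> 1 k + \<delta> 3 k" "\<delta> 0" "\<delta> 1"]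
   and X8 = rel[of "\<lambda>k. \<delta> 2 k + \<delta> 3 k" "\<delta> 1" "\<delta> 0"]
  have sums: "(\<Sum>i<2. f i) = f 0 + f 1" "(\<Sum>i<3. f i) = f 0 + f 1 + f 2"
    "(\<Sum>i<4. f i) = f 0 + f 1 + f 2 + f 3"
    for f :: "nat \<Rightarrow> complex" by (simp_all add: numeral_eq_Suc)
  note s = coord_space_def \<delta>_def sums
  \<comment> \<open>Two unknowns that are each \<open>c\<close> times the other; used with
    \<open>c = 2\<close> and \<open>c = 3\<close>, ratios of weights.\<close>
  have zero: "a = 0 \<and> b = 0" if "a = c * b" "b = c * a" "c * c \<noteq> 1" for a b c :: complex
  proof -
    have "(c * c - 1) * a = c * (c * a) - a" by (simp add: algebra_simps)
    also have "\<dots> = 0" by (simp only: that(2)[symmetric] that(1)[symmetric] diff_self)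
    finally have "a = 0" using that(3) by simp
    then show ?thesis using that(2) by simp
  qed
  have b: "v (1, 1, 0) = 0 \<and> v (2, 1, 0) = 0"
  proof (rule zero)
    show "v (1, 1, 0) = 2 * v (2, 1, 0)" using X3 m by (auto simp: s)
    show "v (2, 1, 0) = 2 * v (1, 1, 0)" using X4 m by (auto simp: s)
  qed simp
  have pairs: "l = 0 \<and> q = 1 \<and> p = 0 \<or> l = 1 \<and> q = 1 \<and> p = 0 \<or> l = 2 \<and> q \<le> m \<and>
      (q = 1 \<and> p = 0 \<or> q = 2 \<and> p = 0 \<or> q = 2 \<and> p = 1 \<or>
       q = 3 \<and> p = 0 \<or> q = 3 \<and> p = 1 \<or> q = 3 \<and> p = 2)"
    if "(l, q, p) \<in> critical_pairs d" for l q p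
  proof -
    have "l < 3" "p < q" and q: "q < d ! l" using that by (auto simp: critical_pairs_def d_def)
    then consider "l = 0" | "l = 1" | "l = 2" by linarith
    then show ?thesis
    proof cases
      case 3
      then have "q \<le> m" using q by (simp add: d_def)
      with \<open>p < q\<close> \<open>m \<le> 3\<close> 3 show ?thesis by presburger
    qed (use \<open>p < q\<close> q in \<open>auto simp: d_def\<close>)
  qed
  \<comment> \<open>For \<open>m = 1\<close> there is no unknown \<open>v (2, 2, 0)\<close>, and
    \<open>X1\<close> contains \<open>v (0, 1, 0)\<close> alone.\<close>
  have a1: "v (0, 1, 0) = 0" if "m = 1" using X1 that by (simp add: s)
  have a2: "v (0, 1, 0) = 0 \<and> v (2, 2, 0) = 0" if "2 \<le> m"
  proof (rule zero)
    show "v (0, 1, 0) = 3 * v (2, 2, 0)" using X1 m that by (auto simp: s)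
    show "v (2, 2, 0) = 3 * v (0, 1, 0)" using X2 m that by (auto simp: s)
  qed simp
  have c: "v (2, 2, 1) = 0" if "2 \<le> m" using X5 m that by (auto simp: s)
  \<comment> \<open>\<open>X7\<close> and \<open>X8\<close> also involve \<open>v (0, 1, 0)\<close>
    and \<open>v (1, 1, 0)\<close>, already known to vanish.\<close>
  have e: "v (2, 3, 0) = 0" "v (2, 3, 1) = 0" "v (2, 3, 2) = 0" if "m = 3"
    using X6 X7 X8 a2 b that by (simp_all add: s)
  have "v (l, q, p) = 0" if "(l, q, p) \<in> critical_pairs d" for l q p
  proof -
    have "v (0, 1, 0) = 0" using a1 a2 m by auto
    then show ?thesis using pairs[OF that] \<open>m \<le> 3\<close> a2 b c e by (elim disjE conjE) auto
  qed
  then show ?thesis by auto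
qed

text \<open>The system has one row for every triple of vectors and one unknown for every critical
  pair; \<open>slice_tensor m\<close> is the tensor at which it is injective.\<close>

lemma general_critical_forms_independent:
  fixes m :: nat
  defines "d \<equiv> [2, 2, Suc m, m + 4]"
  assumes m: "m = 1 \<or> m = 2 \<or> m = 3"
  shows "holds_for_general_tensor d (\<lambda>T. \<forall>v. (\<forall>x y z. (\<Sum>(l, q, p)\<in>critical_pairs d.
      v (l, q, p) * critical_form d T l p q (graph_tensor d T [x, y, z])) = 0) \<longrightarrow>
    (\<forall>j\<in>critical_pairs d. v j = 0))"
proof -
  define A :: "(nat \<Rightarrow> complex) \<times> (nat \<Rightarrow> complex) \<times> (nat \<Rightarrow> complex) \<Rightarrow>
      nat \<times> nat \<times> nat \<Rightarrow> (nat list \<Rightarrow> complex) \<Rightarrow> complex"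
    where "A = (\<lambda>(x, y, z) (l, q, p) T. critical_form d T l p q (graph_tensor d T [x, y, z]))"
  have A: "(\<Sum>j\<in>critical_pairs d. v j * A (x, y, z) j T) = (\<Sum>(l, q, p)\<in>critical_pairs d.
      v (l, q, p) * critical_form d T l p q (graph_tensor d T [x, y, z]))" for v x y z T
    by (intro sum.cong) (auto simp: A_def)
  have "holds_for_general_tensor d (\<lambda>T. \<forall>v. (\<forall>X\<in>UNIV. (\<Sum>j\<in>critical_pairs d. v j * A X j T) = 0) \<longrightarrow>
    (\<forall>j\<in>critical_pairs d. v j = 0))"
  proof (rule holds_for_general_tensor_injective_system)
    show "slice_tensor m \<in> tensor_space d" by (simp add: tensor_space_def slice_tensor_def d_def)
    show "A X j \<in> polynomial_functions d" if "j \<in> critical_pairs d" for X j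
    proof -
      obtain x y z l q p where eq: "X = (x, y, z)" "j = (l, q, p)" by (metis prod_cases3)
      show ?thesis
        using that polynomial_critical_form_graph_tensor[of d "[x, y, z]" q l p]
        by (simp add: A_def eq critical_pairs_def) (simp add: d_def)
    qed
    fix v assume v: "\<And>X. X \<in> UNIV \<Longrightarrow> (\<Sum>j\<in>critical_pairs d. v j * A X j (slice_tensor m)) = 0"
    show "\<forall>j\<in>critical_pairs d. v j = 0"
      unfolding d_def
      by (rule slice_tensor_independent[OF m], fold d_def, subst A[symmetric]) (rule v[OF UNIV_I])
  qed simp
  then show ?thesis by (simp add: split_paired_all A)
qed

theorem corollary6p8:
  fixes n1 n2 n3 n :: nat and d :: "nat list"
  assumes "(n1, n2, n3) \<in> {(1, 1, 1), (1, 1, 2), (1, 1, 3)}"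
    and "n = n1 + n2 + n3"
    and "d = [n1 + 1, n2 + 1, n3 + 1, n + 2]"
  shows "holds_for_general_tensor d
    (\<lambda>T. proj_span d (singular_points d T) \<subset> projectivization (critical_space d T))"
proof -
  \<comment> \<open>As \<open>n1 = n2 = 1\<close>, the last dimension \<open>n + 2\<close> is
    \<open>n3 + 4\<close>, so \<open>n3\<close> takes the role of \<open>m\<close>.\<close>
  have m: "n3 = 1 \<or> n3 = 2 \<or> n3 = 3" and d: "d = [2, 2, Suc n3, n3 + 4]"
    using assms by auto
  have count: "(\<Sum>q<2. Suc q) * (\<Sum>q<2. Suc q) * (\<Sum>q<Suc n3. Suc q) + (\<Sum>q<n3 + 4. q) <
      2 * 2 * Suc n3 * (n3 + 4)"
    using m by (elim disjE) (simp_all add: numeral_eq_Suc)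
  have "proj_span d (singular_points d T) \<subset> projectivization (critical_space d T)"
    if nonzero: "\<forall>x y z. x \<in> coord_space 2 \<longrightarrow> y \<in> coord_space 2 \<longrightarrow> z \<in> coord_space (Suc n3) \<longrightarrow>
        x \<noteq> 0 \<longrightarrow> y \<noteq> 0 \<longrightarrow> z \<noteq> 0 \<longrightarrow> last_contraction d T [x, y, z] \<noteq> 0"
      and indep: "\<forall>v. (\<forall>x y z. (\<Sum>(l, q, p)\<in>critical_pairs d.
        v (l, q, p) * critical_form d T l p q (graph_tensor d T [x, y, z])) = 0) \<longrightarrow>
        (\<forall>j\<in>critical_pairs d. v j = 0)" for T
  proof -
    let ?W = "cfun.span (range (\<lambda>(x, y, z). graph_tensor d T [x, y, z]))"
    have "\<exists>z\<in>critical_space d T. z \<notin> ?W"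
      using indep by (intro critical_space_not_in_graph_span[OF d count]) blast
    then obtain z where z: "z \<in> critical_space d T" "z \<notin> ?W" by blast
    have "rank_one_tensor d xs \<in> ?W" if xs: "singular_vector_tuple d T xs" for xs
    proof -
      have "length xs = 4" using xs by (simp add: singular_vector_tuple_def d)
      then obtain x y z w where eq: "xs = [x, y, z] @ [w]"
        by (auto simp: numeral_eq_Suc length_Suc_conv)
      have "\<forall>l<4. xs ! l \<in> coord_space (d ! l) \<and> xs ! l \<noteq> 0"
        using xs by (simp add: singular_vector_tuple_def d)
      then have "last_contraction d T [x, y, z] \<noteq> 0"
        using nonzero unfolding eq d by (simp add: numeral_eq_Suc All_less_Suc2)
      then obtain c where "rank_one_tensor d xs = cscale c (graph_tensor d T [x, y, z])"
        using singular_vector_tuple_graph_tensor[of d T "[x, y, z]" w] xs eq by metis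
      moreover have "graph_tensor d T [x, y, z] \<in> ?W"
        by (rule cfun.span_base, rule range_eqI[of _ _ "(x, y, z)"]) simp
      ultimately show ?thesis by (simp only: cfun.span_scale)
    qed
    then show ?thesis by (intro proj_span_singular_points_psubset[OF cfun.subspace_span _ z])
  qed
  with holds_for_general_tensor_conj[OF general_last_contraction_nonzero
      general_critical_forms_independent[OF m], folded d]
  show ?thesis by (elim holds_for_general_tensor_mono) simp
qed

end
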